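(* Let $T:\Delta\to\Delta$ be the tower map of an aperiodic induced weak Gibbs Markov (WGM) map $f^R:\Delta_0\to\Delta_0$ with a coprime block and $R\in L^1(m)$. Let $\nu$ be the unique ergodic $T$-invariant probability measure with $\nu\ll m$. Then $\nu$ is exact.
   Context: **WGM map.** Let $(\Delta_0,\mathcal A,m)$ be a measure space with $0<m(\Delta_0)<\infty$, $F:\Delta_0\to\Delta_0$ measurable, and $\mathcal P_0$ a finite or countable ($m$ mod 0) partition of $\Delta_0$ into invertibility domains of $F$ ($F$ is a bijection from each $\omega\in\mathcal P_0$ onto $F(\omega)$ with measurable inverse). Put $\mathcal P_0^n=\bigvee_{i=0}^{n-1}F^{-i}(\mathcal P_0)$. $F$ is a weak Gibbs Markov (WGM) map with respect to $\mathcal P_0$ if: (W1) Markov: $F$ maps each $\omega\in\mathcal P_0$ bijectively to an ($m$ mod 0) union of elements of $\mathcal P_0$; (W2) Separability: the sequence $(\mathcal P_0^n)_n$ generates $\mathcal A$ ($m$ mod 0) and $\bigvee_{i=0}^\infty F^{-i}(\mathcal P_0)$ is the partition into single points; (W3) Nonsingular: there is a strictly positive measurable function $J_F$ on $\Delta_0$ with $m(F(A))=\int_AJ_F\,dm$ for each measurable $A\subset\omega\in\mathcal P_0$; (W4) Gibbs: there are $C_F>0$ and $0<\beta<1$ such that for all $\omega\in\mathcal P_0$ and $x,y\in\omega$, $\log\frac{J_F(x)}{J_F(y)}\le C_F\beta^{s(F(x),F(y))}$, where $s(x,y)=\min\{n\ge0: F^n(x)\text{ and }F^n(y)\text{ lie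 in distinct elements of }\mathcal P_0\}$; (W5) Long branches: there is $\delta_0>0$ with $m(F(\omega))\ge\delta_0$ for all $\omega\in\mathcal P_0$. **Induced map.** Let $(M,\mathcal B,m)$ be a measure space, $f:M\to M$ measurable, $\Delta_0\subset M$. $F:\Delta_0\to\Delta_0$ is an induced map for $f$, denoted $f^R$, if there are a countable ($m$ mod 0) partition $\mathcal P_0$ of $\Delta_0$ and a measurable $R:\Delta_0\to\mathbb N$, constant on elements of $\mathcal P_0$, with $F|_\omega=f^{R(\omega)}|_\omega$ for $\omega\in\mathcal P_0$. The restriction of $m$ to $\Delta_0$ is also denoted $m$. - *Aperiodic*: for all $\omega_1,\omega_2\in\mathcal P_0$ there is $k_0\in\mathbb N$ such that $m(\omega_1\cap(f^R)^{-n}(\omega_2))>0$ for all $n\ge k_0$. - *Coprime block*: there exist $N\ge2$ and $\omega_1,\dots,\omega_N\in\mathcal P_0$ with $\gcd\{R(\omega_i)\}_i=1$ and $f^R(\omega_i)\supseteq\omega_1\cup\cdots\cup\omega_N$ ($m$ mod 0) for all $i=1,\dots,N$. **Tower.** $\Delta=\{(x,\ell):x\in\Delta_0,\ R(x)>\ell\ge0\}$, and $T(x,\ell)=(x,\ell+1)$ if $R(x)>\ell+1$, $T(x,\ell)=(f^R(x),0)$ if $R(x)=\ell+1$. The $\ell$th level $\Delta_\ell=\{(x,\ell)\in\Delta\}$ is identified with $\{R>\ell\}\subset\Delta_0$ (in particular the level $0$ with $\Delta_0$), and the $\sigma$-algebra $\mathcal A$ and the measure $m$ are extended to $\Delta$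 through these identifications (still denoted $\mathcal A$, $m$); thus $m(\Delta)=\int_{\Delta_0}R\,dm<\infty$. $\nu$ is exact if every $A\in\bigcap_nT^{-n}(\mathcal A)$ has $\nu(A)\in\{0,1\}$. (Under these hypotheses $T$ has a unique ergodic invariant probability measure $\nu\ll m$, and $d\nu/dm$ is positive and bounded above.) *)

theory Defs
  imports "HOL-Probability.Probability"
begin

text \<open>
  A measure space is a value of type \<^typ>\<open>'a measure\<close>; the set of its points is \<open>space M\<close>, and a
  self-map of it is a total function \<open>F :: 'a \<Rightarrow> 'a\<close> with \<open>F \<in> M \<rightarrow>\<^sub>M M\<close>.
\<close>

section \<open>Partitions and refinements\<close>

definition eq_mod0 :: "'a measure \<Rightarrow> 'a set \<Rightarrow> 'a set \<Rightarrow> bool" where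
  "eq_mod0 M A B \<longleftrightarrow> (A - B) \<union> (B - A) \<in> null_sets M"

text \<open>Both disjointness and covering are only required up to null sets.\<close>

definition mod0_partition :: "'a measure \<Rightarrow> 'a set set \<Rightarrow> bool" where
  "mod0_partition M P \<longleftrightarrow>
     countable P \<and> P \<subseteq> sets M \<and>
     (\<forall>\<omega>\<in>P. \<forall>\<omega>'\<in>P. \<omega> \<noteq> \<omega>' \<longrightarrow> \<omega> \<inter> \<omega>' \<in> null_sets M) \<and>
     space M - \<Union>P \<in> null_sets M"

text \<open>
  The elements of \<open>\<Or>\<^bsub>i \<in> I\<^esub> F\<^sup>-\<^sup>i(P)\<close>. The empty set may occur among them; it is harmless in the
  generated \<open>\<sigma>\<close>-algebra and is excluded explicitly in the condition on single points.
\<close>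

definition refinement :: "'a measure \<Rightarrow> ('a \<Rightarrow> 'a) \<Rightarrow> 'a set set \<Rightarrow> nat set \<Rightarrow> 'a set set" where
  "refinement M F P I =
     {space M \<inter> (\<Inter>i\<in>I. (F ^^ i) -` w i) | w. \<forall>i\<in>I. w i \<in> P}"

text \<open>\<open>F\<close> is a bijection from \<open>\<omega>\<close> onto the measurable set \<open>F(\<omega>)\<close>, with measurable inverse.\<close>

definition invertibility_domain :: "'a measure \<Rightarrow> ('a \<Rightarrow> 'a) \<Rightarrow> 'a set \<Rightarrow> bool" where
  "invertibility_domain M F \<omega> \<longleftrightarrow>
     inj_on F \<omega> \<and> F ` \<omega> \<in> sets M \<and>
     the_inv_into \<omega> F \<in> restrict_space M (F ` \<omega>) \<rightarrow>\<^sub>M restrict_space M \<omega>"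

section \<open>Weak Gibbs Markov maps\<close>

text \<open>The infimum of the empty set is \<open>\<infinity>\<close>.\<close>

definition separation_time :: "('a \<Rightarrow> 'a) \<Rightarrow> 'a set set \<Rightarrow> 'a \<Rightarrow> 'a \<Rightarrow> enat" where
  "separation_time F P x y =
     (INF n \<in> {n. \<exists>\<omega>\<in>P. \<exists>\<omega>'\<in>P. \<omega> \<noteq> \<omega>' \<and> (F ^^ n) x \<in> \<omega> \<and> (F ^^ n) y \<in> \<omega>'}. enat n)"

definition WGM_markov :: "'a measure \<Rightarrow> ('a \<Rightarrow> 'a) \<Rightarrow> 'a set set \<Rightarrow> bool" where
  "WGM_markov M F P \<longleftrightarrow> (\<forall>\<omega>\<in>P. inj_on F \<omega> \<and> (\<exists>Q\<subseteq>P. eq_mod0 M (F ` \<omega>) (\<Union>Q)))"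

definition WGM_separability :: "'a measure \<Rightarrow> ('a \<Rightarrow> 'a) \<Rightarrow> 'a set set \<Rightarrow> bool" where
  "WGM_separability M F P \<longleftrightarrow>
     (\<forall>A\<in>sets M. \<exists>B\<in>sigma_sets (space M) (\<Union>n. refinement M F P {..<n}). eq_mod0 M A B) \<and>
     (\<forall>C\<in>refinement M F P UNIV. C \<noteq> {} \<longrightarrow> is_singleton C)"

definition WGM_nonsingular :: "'a measure \<Rightarrow> ('a \<Rightarrow> 'a) \<Rightarrow> 'a set set \<Rightarrow> ('a \<Rightarrow> real) \<Rightarrow> bool" where
  "WGM_nonsingular M F P J \<longleftrightarrow>
     J \<in> borel_measurable M \<and> (\<forall>x\<in>space M. J x > 0) \<and>
     (\<forall>\<omega>\<in>P. \<forall>A\<in>sets M. A \<subseteq> \<omega> \<longrightarrow> emeasure M (F ` A) = (\<integral>\<^sup>+x\<in>A. ennreal (J x) \<partial>M))"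

text \<open>
  Pairs of points of \<open>\<omega>\<close> whose images have infinite separation time are exempt. Among points whose
  orbits stay in \<open>\<Union>P\<close>, separability and injectivity on \<open>\<omega>\<close> leave only the pairs \<open>x = y\<close>,
  for which the left-hand side is \<open>0\<close>.
\<close>

definition WGM_gibbs :: "('a \<Rightarrow> 'a) \<Rightarrow> 'a set set \<Rightarrow> ('a \<Rightarrow> real) \<Rightarrow> bool" where
  "WGM_gibbs F P J \<longleftrightarrow>
     (\<exists>C>0. \<exists>\<beta>. 0 < \<beta> \<and> \<beta> < 1 \<and>
        (\<forall>\<omega>\<in>P. \<forall>x\<in>\<omega>. \<forall>y\<in>\<omega>. \<forall>n. separation_time F P (F x) (F y) = enat n \<longrightarrow>
           ln (J x / J y) \<le> C * \<beta> ^ n))"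

definition WGM_long_branches :: "'a measure \<Rightarrow> ('a \<Rightarrow> 'a) \<Rightarrow> 'a set set \<Rightarrow> bool" where
  "WGM_long_branches M F P \<longleftrightarrow> (\<exists>\<delta>::real. \<delta> > 0 \<and> (\<forall>\<omega>\<in>P. emeasure M (F ` \<omega>) \<ge> ennreal \<delta>))"

definition weak_gibbs_markov :: "'a measure \<Rightarrow> ('a \<Rightarrow> 'a) \<Rightarrow> 'a set set \<Rightarrow> bool" where
  "weak_gibbs_markov M F P \<longleftrightarrow>
     0 < emeasure M (space M) \<and> emeasure M (space M) < \<infinity> \<and>
     F \<in> M \<rightarrow>\<^sub>M M \<and> mod0_partition M P \<and> (\<forall>\<omega>\<in>P. invertibility_domain M F \<omega>) \<and>
     WGM_markov M F P \<and> WGM_separability M F P \<and>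
     (\<exists>J. WGM_nonsingular M F P J \<and> WGM_gibbs F P J) \<and>
     WGM_long_branches M F P"

section \<open>Induced maps\<close>

text \<open>
  Return times are positive. \<open>F\<close> is a parameter, since \<open>f\<close> and \<open>R\<close> determine it only on \<open>\<Union>P\<close>.
\<close>

definition induced_map ::
  "'a measure \<Rightarrow> ('a \<Rightarrow> 'a) \<Rightarrow> 'a set \<Rightarrow> 'a set set \<Rightarrow> ('a \<Rightarrow> nat) \<Rightarrow> ('a \<Rightarrow> 'a) \<Rightarrow> bool" where
  "induced_map M f \<Delta>\<^sub>0 P R F \<longleftrightarrow>
     f \<in> M \<rightarrow>\<^sub>M M \<and> \<Delta>\<^sub>0 \<in> sets M \<and> F \<in> \<Delta>\<^sub>0 \<rightarrow> \<Delta>\<^sub>0 \<and>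
     mod0_partition (restrict_space M \<Delta>\<^sub>0) P \<and>
     R \<in> restrict_space M \<Delta>\<^sub>0 \<rightarrow>\<^sub>M count_space UNIV \<and> (\<forall>x\<in>\<Delta>\<^sub>0. 0 < R x) \<and>
     (\<forall>\<omega>\<in>P. R constant_on \<omega>) \<and> (\<forall>\<omega>\<in>P. \<forall>x\<in>\<omega>. F x = (f ^^ R x) x)"

definition aperiodic :: "'a measure \<Rightarrow> ('a \<Rightarrow> 'a) \<Rightarrow> 'a set set \<Rightarrow> bool" where
  "aperiodic M F P \<longleftrightarrow>
     (\<forall>\<omega>\<^sub>1\<in>P. \<forall>\<omega>\<^sub>2\<in>P. \<exists>k\<^sub>0. \<forall>n\<ge>k\<^sub>0. emeasure M (\<omega>\<^sub>1 \<inter> (F ^^ n) -` \<omega>\<^sub>2) > 0)"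

text \<open>As \<open>R\<close> is constant on partition elements, \<open>R ` \<omega> i\<close> is the singleton of \<open>R(\<omega>\<^sub>i)\<close>.\<close>

definition coprime_block ::
  "'a measure \<Rightarrow> ('a \<Rightarrow> 'a) \<Rightarrow> 'a set set \<Rightarrow> ('a \<Rightarrow> nat) \<Rightarrow> bool" where
  "coprime_block M F P R \<longleftrightarrow>
     (\<exists>N\<ge>2. \<exists>\<omega>::nat \<Rightarrow> 'a set. (\<forall>i\<in>{1..N}. \<omega> i \<in> P) \<and>
        Gcd (\<Union>i\<in>{1..N}. R ` \<omega> i) = 1 \<and>
        (\<forall>i\<in>{1..N}. (\<Union>j\<in>{1..N}. \<omega> j) - F ` \<omega> i \<in> null_sets M))"

section \<open>Towers\<close>

definition tower_space :: "'a measure \<Rightarrow> ('a \<Rightarrow> nat) \<Rightarrow> ('a \<times> nat) set" where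
  "tower_space M R = {(x, l). x \<in> space M \<and> l < R x}"

definition tower_map :: "('a \<Rightarrow> 'a) \<Rightarrow> ('a \<Rightarrow> nat) \<Rightarrow> 'a \<times> nat \<Rightarrow> 'a \<times> nat" where
  "tower_map F R = (\<lambda>(x, l). if l + 1 < R x then (x, l + 1) else (F x, 0))"

text \<open>
  A subset \<open>A\<close> of the tower is measurable iff every level of it is, and its measure is the sum of the
  measures of its levels, the level \<open>l\<close> of \<open>A\<close> being viewed as a subset of \<open>{R > l}\<close>.
\<close>

definition tower_measure :: "'a measure \<Rightarrow> ('a \<Rightarrow> nat) \<Rightarrow> ('a \<times> nat) measure" where
  "tower_measure M R =
     measure_of (tower_space M R)
       {A. A \<subseteq> tower_space M R \<and> (\<forall>l. {x. (x, l) \<in> A} \<in> sets M)}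
       (\<lambda>A. \<Sum>l. emeasure M {x. (x, l) \<in> A})"

lemma tower_sigma_algebra:
  assumes R: "R \<in> M \<rightarrow>\<^sub>M count_space UNIV"
  shows "sigma_algebra (tower_space M R)
           {A. A \<subseteq> tower_space M R \<and> (\<forall>l. {x. (x, l) \<in> A} \<in> sets M)}"
proof -
  have lev: "{x. (x, l) \<in> tower_space M R} \<in> sets M" for l
  proof -
    have "{x. (x, l) \<in> tower_space M R} = R -` {l<..} \<inter> space M"
      by (auto simp: tower_space_def)
    then show ?thesis using R by (simp add: measurable_sets)
  qed
  show ?thesis
    unfolding sigma_algebra_iff2
  proof (intro conjI allI impI ballI)
    fix A assume A: "A \<in> {A. A \<subseteq> tower_space M R \<and> (\<forall>l. {x. (x, l) \<in> A} \<in> sets M)}"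
    have "{x. (x, l) \<in> tower_space M R - A}
            = {x. (x, l) \<in> tower_space M R} - {x. (x, l) \<in> A}" for l
      by auto
    with A lev
    show "tower_space M R - A \<in> {A. A \<subseteq> tower_space M R \<and> (\<forall>l. {x. (x, l) \<in> A} \<in> sets M)}"
      by auto
  next
    fix A :: "nat \<Rightarrow> ('a \<times> nat) set"
    assume A: "range A \<subseteq> {A. A \<subseteq> tower_space M R \<and> (\<forall>l. {x. (x, l) \<in> A} \<in> sets M)}"
    have "{x. (x, l) \<in> (\<Union>i. A i)} = (\<Union>i. {x. (x, l) \<in> A i})" for l
      by auto
    moreover have "(\<Union>i. {x. (x, l) \<in> A i}) \<in> sets M" for l
      using A by (intro sets.countable_UN) auto
    ultimately
    show "(\<Union>i. A i) \<in> {A. A \<subseteq> tower_space M R \<and> (\<forall>l. {x. (x, l) \<in> A} \<in> sets M)}"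
      using A by auto
  qed auto
qed

lemma space_tower_measure: "space (tower_measure M R) = tower_space M R"
  unfolding tower_measure_def by (rule space_measure_of) auto

lemma sets_tower_measure:
  assumes "R \<in> M \<rightarrow>\<^sub>M count_space UNIV"
  shows "sets (tower_measure M R)
           = {A. A \<subseteq> tower_space M R \<and> (\<forall>l. {x. (x, l) \<in> A} \<in> sets M)}"
  unfolding tower_measure_def
  by (rule sigma_algebra.sets_measure_of_eq[OF tower_sigma_algebra[OF assms]])

lemma emeasure_tower_measure:
  assumes R: "R \<in> M \<rightarrow>\<^sub>M count_space UNIV" and A: "A \<in> sets (tower_measure M R)"
  shows "emeasure (tower_measure M R) A = (\<Sum>l. emeasure M {x. (x, l) \<in> A})"
proof (rule emeasure_measure_of[OF tower_measure_def _ _ _ A])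
  show "positive (sets (tower_measure M R)) (\<lambda>A. \<Sum>l. emeasure M {x. (x, l) \<in> A})"
    by (simp add: positive_def)
  show "countably_additive (sets (tower_measure M R)) (\<lambda>A. \<Sum>l. emeasure M {x. (x, l) \<in> A})"
  proof (rule countably_additiveI)
    fix B :: "nat \<Rightarrow> ('a \<times> nat) set"
    assume B: "range B \<subseteq> sets (tower_measure M R)" and dis: "disjoint_family B"
    have "(\<Sum>i. \<Sum>l. emeasure M {x. (x, l) \<in> B i}) = (\<Sum>l. \<Sum>i. emeasure M {x. (x, l) \<in> B i})"
      using nn_integral_suminf[of "\<lambda>i l. emeasure M {x. (x, l) \<in> B i}" "count_space (UNIV :: nat set)"]
      by (simp add: nn_integral_count_space_nat)
    also have "\<dots> = (\<Sum>l. emeasure M {x. (x, l) \<in> (\<Union>i. B i)})"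
    proof (intro suminf_cong)
      fix l
      have "(\<Sum>i. emeasure M {x. (x, l) \<in> B i}) = emeasure M (\<Union>i. {x. (x, l) \<in> B i})"
      proof (rule suminf_emeasure)
        show "range (\<lambda>i. {x. (x, l) \<in> B i}) \<subseteq> sets M"
          using B by (auto simp: sets_tower_measure[OF R])
        show "disjoint_family (\<lambda>i. {x. (x, l) \<in> B i})"
          using dis by (fastforce simp: disjoint_family_on_def)
      qed
      also have "(\<Union>i. {x. (x, l) \<in> B i}) = {x. (x, l) \<in> (\<Union>i. B i)}"
        by auto
      finally show "(\<Sum>i. emeasure M {x. (x, l) \<in> B i}) = emeasure M {x. (x, l) \<in> (\<Union>i. B i)}" .
    qed
    finally show "(\<Sum>i. \<Sum>l. emeasure M {x. (x, l) \<in> B i}) = (\<Sum>l. emeasure M {x. (x, l) \<in> (\<Union>i. B i)})" .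
  qed
qed auto

lemma measurable_tower_map:
  assumes R: "R \<in> M \<rightarrow>\<^sub>M count_space UNIV" and Rpos: "\<And>x. x \<in> space M \<Longrightarrow> 0 < R x"
    and F: "F \<in> M \<rightarrow>\<^sub>M M"
  shows "tower_map F R \<in> tower_measure M R \<rightarrow>\<^sub>M tower_measure M R"
proof (rule measurableI)
  fix z assume "z \<in> space (tower_measure M R)"
  then show "tower_map F R z \<in> space (tower_measure M R)"
    using Rpos measurable_space[OF F]
    by (cases z) (simp add: space_tower_measure tower_space_def tower_map_def)
next
  fix A assume A: "A \<in> sets (tower_measure M R)"
  have lev: "{x. (x, l) \<in> A} \<in> sets M" for l
    using A by (auto simp: sets_tower_measure[OF R])
  have sub: "x \<in> space M" if "(x, l) \<in> A" for x l
    using A that by (auto simp: sets_tower_measure[OF R] tower_space_def)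
  have subR: "l < R x" if "(x, l) \<in> A" for x l
    using A that by (auto simp: sets_tower_measure[OF R] tower_space_def)
  have "{x. (x, l) \<in> tower_map F R -` A \<inter> tower_space M R}
          = {x. (x, l + 1) \<in> A} \<union> (F -` {x. (x, 0) \<in> A} \<inter> space M) \<inter> (R -` {l + 1} \<inter> space M)" for l
    by (auto simp: tower_map_def tower_space_def dest: sub subR split: if_splits)
  moreover have "{x. (x, l + 1) \<in> A} \<union> (F -` {x. (x, 0) \<in> A} \<inter> space M) \<inter> (R -` {l + 1} \<inter> space M) \<in> sets M" for l
    using lev measurable_sets[OF F lev] measurable_sets[OF R, of "{l + 1}"] by auto
  ultimately show "tower_map F R -` A \<inter> space (tower_measure M R) \<in> sets (tower_measure M R)"
    by (auto simp: sets_tower_measure[OF R] space_tower_measure)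
qed

section \<open>Invariance, ergodicity, exactness\<close>

definition invariant_measure :: "'b measure \<Rightarrow> ('b \<Rightarrow> 'b) \<Rightarrow> bool" where
  "invariant_measure \<nu> T \<longleftrightarrow> T \<in> \<nu> \<rightarrow>\<^sub>M \<nu> \<and> distr \<nu> \<nu> T = \<nu>"

definition ergodic_measure :: "'b measure \<Rightarrow> ('b \<Rightarrow> 'b) \<Rightarrow> bool" where
  "ergodic_measure \<nu> T \<longleftrightarrow>
     (\<forall>A\<in>sets \<nu>. T -` A \<inter> space \<nu> = A \<longrightarrow> emeasure \<nu> A = 0 \<or> emeasure \<nu> A = 1)"

definition exact_measure :: "'b measure \<Rightarrow> ('b \<Rightarrow> 'b) \<Rightarrow> bool" where
  "exact_measure \<nu> T \<longleftrightarrow>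
     (\<forall>A\<in>(\<Inter>n. {(T ^^ n) -` B \<inter> space \<nu> | B. B \<in> sets \<nu>}). emeasure \<nu> A = 0 \<or> emeasure \<nu> A = 1)"

end

theory Submission
  imports Defs
begin

text \<open>
  Let \<open>A\<close> be an event of positive measure in the tail, say \<open>A = T\<^sup>-\<^sup>n(B\<^sub>n)\<close> for every \<open>n\<close>. All the \<open>B\<^sub>n\<close> have
  the same \<open>\<nu>\<close>-measure as \<open>A\<close>, so it is enough to show that they fill up the tower along some sequence
  of times. Three facts give this.

  \<^item> Density. Cylinders of the base map \<open>F\<close> generate the \<open>\<sigma>\<close>-algebra, so some cylinder \<open>Z\<close> is occupied
  by \<open>A\<close> up to an arbitrarily small proportion (\<open>ex_full_cylinder\<close>). Pulling \<open>A\<close> back by a power of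
  \<open>T\<close> allows the cylinder to be taken in the base.

  \<^item> Distortion. If \<open>Z\<close> has depth \<open>n\<close>, then \<open>F\<^sup>n\<close> maps \<open>Z\<close> onto the full image \<open>F(\<omega>)\<close> of a partition
  element, and it changes relative measures by a bounded factor (\<open>distortion\<close>). So the part of \<open>F(\<omega>)\<close>
  missed by the image of \<open>A\<close> is small. Images of partition elements are not small, so one of finitely
  many partition elements lies in \<open>F(\<omega>)\<close>; by pigeonhole one element \<open>b\<close> works for every precision
  (\<open>ex_filled_element\<close>). Borel-Cantelli turns this into: along some sequence of times \<open>t\<^sub>k\<close> and for every
  fixed delay \<open>K\<close>, almost every point of \<open>b\<close> is, after \<open>K\<close> further steps, in \<open>B\<close> at time \<open>t\<^sub>k + K\<close> for
  all large \<open>k\<close>.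

  \<^item> Mixing of the partition. Aperiodicity leads from any element of the partition to any other one, and
  the coprime block provides returns to itself at all large times, because these times form a numerical
  semigroup with greatest common divisor 1. Hence \<open>T\<^sup>K(b)\<close> contains any given cell of the tower for all
  large \<open>K\<close> (\<open>eventually_covers\<close>).

  Fatou's lemma, first in \<open>k\<close> and then in \<open>K\<close>, bounds the measure of the whole tower by \<open>\<nu>(A)\<close>.
\<close>

section \<open>Nonsingularity of weak Gibbs Markov maps\<close>

text \<open>
  The Jacobian and the constants of the Gibbs condition are parameters, so that the distortion constant
  can be written down.
\<close>

locale wgm_map =
  fixes M :: "'a measure" and F :: "'a \<Rightarrow> 'a" and P :: "'a set set"
    and J :: "'a \<Rightarrow> real" and C \<beta> :: real
  assumes wgm: "weak_gibbs_markov M F P"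
    and nonsingular: "WGM_nonsingular M F P J"
    and C: "0 < C" and \<beta>: "0 < \<beta>" "\<beta> < 1"
    and gibbs: "\<And>\<omega> x y n. \<omega> \<in> P \<Longrightarrow> x \<in> \<omega> \<Longrightarrow> y \<in> \<omega> \<Longrightarrow> separation_time F P (F x) (F y) = enat n
                  \<Longrightarrow> ln (J x / J y) \<le> C * \<beta> ^ n"
begin

lemma finite_measure_M: "finite_measure M"
  using wgm by (intro finite_measureI) (auto simp: weak_gibbs_markov_def)

sublocale finite_measure M by (rule finite_measure_M)

lemma F_measurable [measurable]: "F \<in> M \<rightarrow>\<^sub>M M"
  using wgm by (simp add: weak_gibbs_markov_def)

lemma funpow_measurable [measurable]: "F ^^ n \<in> M \<rightarrow>\<^sub>M M"
proof (induction n)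
  case (Suc n)
  then show ?case
    unfolding funpow.simps by (rule measurable_comp[OF _ F_measurable])
qed auto

lemma countable_P: "countable P"
  and sets_P: "\<And>\<omega>. \<omega> \<in> P \<Longrightarrow> \<omega> \<in> sets M"
  and Int_P_null: "\<And>\<omega> \<omega>'. \<omega> \<in> P \<Longrightarrow> \<omega>' \<in> P \<Longrightarrow> \<omega> \<noteq> \<omega>' \<Longrightarrow> \<omega> \<inter> \<omega>' \<in> null_sets M"
  and compl_P_null: "space M - \<Union>P \<in> null_sets M"
  using wgm by (auto simp: weak_gibbs_markov_def mod0_partition_def)

lemma P_subset_space: "\<omega> \<in> P \<Longrightarrow> \<omega> \<subseteq> space M"
  using sets_P sets.sets_into_space by blast

lemma F_space: "x \<in> space M \<Longrightarrow> F x \<in> space M"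
  using measurable_space[OF F_measurable] .

lemma funpow_space: "x \<in> space M \<Longrightarrow> (F ^^ n) x \<in> space M"
  using measurable_space[OF funpow_measurable] .

lemma inj_on_P: "\<omega> \<in> P \<Longrightarrow> inj_on F \<omega>"
  using wgm by (auto simp: weak_gibbs_markov_def invertibility_domain_def)

lemma image_sets:
  assumes "\<omega> \<in> P" "A \<in> sets M" "A \<subseteq> \<omega>"
  shows "F ` A \<in> sets M"
proof -
  have Fw: "F ` \<omega> \<in> sets M"
    and inv: "the_inv_into \<omega> F \<in> restrict_space M (F ` \<omega>) \<rightarrow>\<^sub>M restrict_space M \<omega>"
    using wgm assms(1) by (auto simp: weak_gibbs_markov_def invertibility_domain_def)
  have "A \<in> sets (restrict_space M \<omega>)"
    using assms sets_P by (auto simp: sets_restrict_space_iff)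
  from measurable_sets[OF inv this]
  have "the_inv_into \<omega> F -` A \<inter> (F ` \<omega> \<inter> space M) \<in> sets M"
    using Fw by (auto simp: sets_restrict_space_iff space_restrict_space)
  moreover have "the_inv_into \<omega> F -` A \<inter> (F ` \<omega> \<inter> space M) = F ` A"
    using assms inj_on_P[OF assms(1)] P_subset_space[OF assms(1)] F_space
    by (auto simp: the_inv_into_f_f image_iff subset_iff)
  ultimately show ?thesis by simp
qed

lemma J_measurable [measurable]: "J \<in> borel_measurable M"
  and J_pos: "\<And>x. x \<in> space M \<Longrightarrow> 0 < J x"
  and emeasure_image: "\<And>\<omega> A. \<omega> \<in> P \<Longrightarrow> A \<in> sets M \<Longrightarrow> A \<subseteq> \<omega>
        \<Longrightarrow> emeasure M (F ` A) = (\<integral>\<^sup>+x\<in>A. ennreal (J x) \<partial>M)"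
  using nonsingular by (auto simp: WGM_nonsingular_def)

text \<open>
  The Jacobian is strictly positive, so the integral that gives the measure of \<open>F(A)\<close> vanishes only
  if \<open>A\<close> is null.
\<close>

lemma image_null_iff:
  assumes "\<omega> \<in> P" "A \<in> sets M" "A \<subseteq> \<omega>"
  shows "F ` A \<in> null_sets M \<longleftrightarrow> A \<in> null_sets M"
proof -
  have "emeasure M (F ` A) = 0 \<longleftrightarrow> (AE x in M. ennreal (J x) * indicator A x = 0)"
    unfolding emeasure_image[OF assms]
    by (rule nn_integral_0_iff_AE) (use assms in measurable)
  also have "\<dots> \<longleftrightarrow> (AE x in M. x \<notin> A)"
  proof (rule AE_cong)
    fix x assume "x \<in> space M"
    then show "ennreal (J x) * indicator A x = 0 \<longleftrightarrow> x \<notin> A"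
      using J_pos[of x] by (simp add: indicator_def ennreal_eq_0_iff)
  qed
  also have "\<dots> \<longleftrightarrow> A \<in> null_sets M"
    using assms AE_iff_null_sets by blast
  finally show ?thesis
    using image_sets[OF assms] assms by (auto simp: null_sets_def)
qed

lemma vimage_null:
  assumes N: "N \<in> null_sets M"
  shows "F -` N \<inter> space M \<in> null_sets M"
proof (rule null_sets_subset)
  have "F -` N \<inter> \<omega> \<in> null_sets M" if w: "\<omega> \<in> P" for \<omega>
  proof -
    have "F -` N \<inter> \<omega> = (F -` N \<inter> space M) \<inter> \<omega>"
      using P_subset_space[OF w] by auto
    then have s: "F -` N \<inter> \<omega> \<in> sets M"
      using measurable_sets[OF F_measurable null_setsD2[OF N]] sets_P[OF w] by auto
    have "F ` (F -` N \<inter> \<omega>) \<in> null_sets M"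
      using image_sets[OF w s] by (intro null_sets_subset[OF N]) auto
    then show ?thesis
      using image_null_iff[OF w s] by auto
  qed
  then have "(\<Union>\<omega>\<in>P. F -` N \<inter> \<omega>) \<in> null_sets M"
    by (intro null_sets_UN' countable_P)
  then show "(\<Union>\<omega>\<in>P. F -` N \<inter> \<omega>) \<union> (space M - \<Union>P) \<in> null_sets M"
    using compl_P_null by auto
  show "F -` N \<inter> space M \<in> sets M"
    using N by (auto intro: measurable_sets)
qed auto

lemma AE_image_point:
  assumes "AE x in M. Q x"
  shows "AE x in M. Q (F x)"
proof -
  obtain N where "{x \<in> space M. \<not> Q x} \<subseteq> N" "N \<in> null_sets M"
    using assms by (auto simp: eventually_ae_filter)
  then show ?thesis
    using vimage_null[of N] F_space by (intro AE_I'[of "F -` N \<inter> space M"]) auto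
qed

lemma AE_funpow_point: "(AE x in M. Q x) \<Longrightarrow> AE x in M. Q ((F ^^ n) x)"
proof (induction n arbitrary: Q)
  case (Suc n)
  then show ?case
    using AE_image_point[of "\<lambda>x. Q ((F ^^ n) x)"] by (simp add: funpow_swap1)
qed auto

text \<open>
  Images of null sets under a branch are null. In this form \<open>Q\<close> may be any predicate, and no
  measurability of images has to be tracked when branches are composed.
\<close>

lemma AE_on_image:
  assumes w: "\<omega> \<in> P" and ae: "AE x in M. x \<in> \<omega> \<longrightarrow> Q (F x)"
  shows "AE y in M. y \<in> F ` \<omega> \<longrightarrow> Q y"
proof -
  obtain N where N: "{x \<in> space M. \<not> (x \<in> \<omega> \<longrightarrow> Q (F x))} \<subseteq> N" "N \<in> null_sets M"
    using ae by (auto simp: eventually_ae_filter)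
  have "N \<inter> \<omega> \<in> null_sets M"
    using N sets_P[OF w] by (simp add: null_set_Int2)
  then have "F ` (N \<inter> \<omega>) \<in> null_sets M"
    using image_null_iff[OF w, of "N \<inter> \<omega>"] by auto
  then show ?thesis
    by (rule AE_I') (use N P_subset_space[OF w] in auto)
qed

section \<open>Transitions and regular points\<close>

definition transition :: "'a set \<Rightarrow> 'a set \<Rightarrow> bool" where
  "transition a b \<longleftrightarrow> 0 < emeasure M (F ` a \<inter> b)"

lemma image_P_sets: "\<omega> \<in> P \<Longrightarrow> F ` \<omega> \<in> sets M"
  by (rule image_sets) (auto simp: sets_P)

text \<open>
  The Markov property leaves no middle ground: \<open>F(a)\<close> is a union of partition elements, so once it
  meets \<open>b\<close> in positive measure, \<open>b\<close> is one of them.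
\<close>

lemma transition_imp_subset:
  assumes a: "a \<in> P" and b: "b \<in> P" and "transition a b"
  shows "b - F ` a \<in> null_sets M"
proof -
  obtain Q where Q: "Q \<subseteq> P" "(F ` a - \<Union>Q) \<union> (\<Union>Q - F ` a) \<in> null_sets M"
    using wgm a by (auto simp: weak_gibbs_markov_def WGM_markov_def eq_mod0_def)
  have s: "b - F ` a \<in> sets M" "F ` a \<inter> b \<in> sets M"
    using a b image_P_sets sets_P by auto
  have "b \<in> Q"
  proof (rule ccontr)
    assume "b \<notin> Q"
    then have "(\<Union>q\<in>Q. q \<inter> b) \<in> null_sets M"
      using Q(1) b countable_P
      by (intro null_sets_UN') (auto intro: Int_P_null countable_subset)
    then have "(\<Union>q\<in>Q. q \<inter> b) \<union> ((F ` a - \<Union>Q) \<union> (\<Union>Q - F ` a)) \<in> null_sets M"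
      using Q(2) by (rule null_sets.Un)
    then have "F ` a \<inter> b \<in> null_sets M"
      by (rule null_sets_subset) (use s in auto)
    then show False
      using assms(3) by (auto simp: transition_def null_sets_def)
  qed
  then show ?thesis
    by (intro null_sets_subset[OF Q(2) s(1)]) auto
qed

text \<open>
  The points at which the first step of the symbolic dynamics fails: they have no symbol, or two symbols,
  or their step joins two elements that communicate only through a null set.
\<close>

definition exceptional :: "'a set" where
  "exceptional = (space M - \<Union>P) \<union> (\<Union>a\<in>P. \<Union>b\<in>P - {a}. a \<inter> b)
     \<union> (\<Union>a\<in>P. \<Union>b\<in>{b \<in> P. \<not> transition a b}. a \<inter> F -` b)"

lemma exceptional_null: "exceptional \<in> null_sets M"
proof -
  have "a \<inter> F -` b \<in> null_sets M" if a: "a \<in> P" and b: "b \<in> P" and "\<not> transition a b" for a b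
  proof -
    have "a \<inter> F -` b = a \<inter> (F -` b \<inter> space M)"
      using P_subset_space[OF a] by auto
    then have s: "a \<inter> F -` b \<in> sets M"
      using measurable_sets[OF F_measurable sets_P[OF b]] sets_P[OF a] by auto
    have "F ` a \<inter> b \<in> null_sets M"
      using that image_P_sets sets_P by (auto simp: transition_def null_sets_def)
    then have "F ` (a \<inter> F -` b) \<in> null_sets M"
      by (rule null_sets_subset) (use image_sets[OF a s] in auto)
    then show ?thesis
      using image_null_iff[OF a s] by auto
  qed
  then have "(\<Union>a\<in>P. \<Union>b\<in>{b \<in> P. \<not> transition a b}. a \<inter> F -` b) \<in> null_sets M"
    by (intro null_sets_UN' countable_P) (auto intro: countable_subset[OF _ countable_P])
  moreover have "(\<Union>a\<in>P. \<Union>b\<in>P - {a}. a \<inter> b) \<in> null_sets M"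
    by (intro null_sets_UN' countable_P)
      (auto intro: countable_subset[OF _ countable_P] Int_P_null)
  ultimately show ?thesis
    unfolding exceptional_def using compl_P_null by auto
qed

text \<open>
  Restricting to a forward invariant set of full measure removes the \<open>mod 0\<close> from the partition:
  every orbit in it has exactly one itinerary, and each of its steps is a transition.
\<close>

definition regular :: "'a set" where
  "regular = {x \<in> space M. \<forall>n. (F ^^ n) x \<notin> exceptional}"

lemma regular_subset: "regular \<subseteq> space M"
  by (auto simp: regular_def)

lemma sets_regular [measurable]: "regular \<in> sets M"
proof -
  have "regular = space M - (\<Union>n. (F ^^ n) -` exceptional \<inter> space M)"
    by (auto simp: regular_def)
  also have "\<dots> \<in> sets M"
    using exceptional_null measurable_sets[OF funpow_measurable] by (intro sets.Diff sets.countable_UN) auto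
  finally show ?thesis .
qed

lemma AE_regular: "AE x in M. x \<in> regular"
proof -
  have "AE x in M. x \<notin> exceptional"
    using exceptional_null by (rule AE_not_in)
  then have "AE x in M. (F ^^ n) x \<notin> exceptional" for n
    by (rule AE_funpow_point)
  then have "AE x in M. \<forall>n. (F ^^ n) x \<notin> exceptional"
    by (simp add: AE_all_countable)
  then show ?thesis
    by (auto simp: regular_def elim: AE_mp)
qed

lemma F_regular: "x \<in> regular \<Longrightarrow> F x \<in> regular"
  unfolding regular_def
proof safe
  fix n assume x: "x \<in> space M" "\<forall>n. (F ^^ n) x \<notin> exceptional" and "(F ^^ n) (F x) \<in> exceptional"
  then have "(F ^^ Suc n) x \<in> exceptional"
    by (simp add: funpow_swap1)
  with x(2) show False by blast
qed (rule F_space)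

lemma funpow_regular: "x \<in> regular \<Longrightarrow> (F ^^ n) x \<in> regular"
  by (induction n) (auto intro: F_regular)

lemma regular_not_exceptional: "x \<in> regular \<Longrightarrow> x \<notin> exceptional"
  unfolding regular_def by (metis (mono_tags, lifting) funpow_0 mem_Collect_eq)

lemma regular_ex: "x \<in> regular \<Longrightarrow> \<exists>\<omega>\<in>P. x \<in> \<omega>"
  using regular_not_exceptional[of x] by (auto simp: regular_def exceptional_def)

lemma regular_unique:
  assumes "x \<in> regular" "a \<in> P" "b \<in> P" "x \<in> a" "x \<in> b"
  shows "a = b"
  using regular_not_exceptional[OF assms(1)] assms unfolding exceptional_def by blast

lemma regular_transition:
  assumes "x \<in> regular" "a \<in> P" "b \<in> P" "x \<in> a" "F x \<in> b"
  shows "transition a b"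
  using regular_not_exceptional[OF assms(1)] assms unfolding exceptional_def by blast

section \<open>Cylinders and bounded distortion\<close>

definition same_itinerary :: "nat \<Rightarrow> 'a \<Rightarrow> 'a \<Rightarrow> bool" where
  "same_itinerary n x y \<longleftrightarrow> (\<forall>i<n. \<forall>\<omega>\<in>P. (F ^^ i) x \<in> \<omega> \<longleftrightarrow> (F ^^ i) y \<in> \<omega>)"

lemma same_itinerary_Suc:
  "same_itinerary (Suc n) x y \<longleftrightarrow> (\<forall>\<omega>\<in>P. x \<in> \<omega> \<longleftrightarrow> y \<in> \<omega>) \<and> same_itinerary n (F x) (F y)"
  unfolding same_itinerary_def All_less_Suc2 by (simp add: funpow_swap1)

definition cylinder :: "nat \<Rightarrow> 'a \<Rightarrow> 'a set" where
  "cylinder n x = {y \<in> regular. same_itinerary n x y}"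

text \<open>
  The Gibbs condition says nothing about a pair whose images are never separated. Separability forces the
  two points of such a regular pair to be equal, since both lie in the same element of
  \<open>\<Or>\<^bsub>i\<^esub> F\<^sup>-\<^sup>i(P)\<close>.
\<close>

lemma J_ratio:
  assumes w: "\<omega> \<in> P" and x: "x \<in> \<omega>" "x \<in> regular" and y: "y \<in> \<omega>" "y \<in> regular"
    and same: "same_itinerary k (F x) (F y)"
  shows "J x \<le> exp (C * \<beta> ^ k) * J y"
proof -
  have Jp: "0 < J x" "0 < J y"
    using x y regular_subset J_pos by auto
  let ?S = "{n. \<exists>\<omega>\<in>P. \<exists>\<omega>'\<in>P. \<omega> \<noteq> \<omega>' \<and> (F ^^ n) (F x) \<in> \<omega> \<and> (F ^^ n) (F y) \<in> \<omega>'}"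
  show ?thesis
  proof (cases "?S = {}")
    case True
    have sym: "(F ^^ n) y \<in> a" if "a \<in> P" "(F ^^ n) x \<in> a" for n a
    proof (cases n)
      case 0
      with that x y show ?thesis
        using regular_unique[OF x(2) w \<open>a \<in> P\<close>] by auto
    next
      case (Suc j)
      obtain b where "b \<in> P" "(F ^^ n) y \<in> b"
        using regular_ex[OF funpow_regular[OF y(2)]] by blast
      moreover have "j \<notin> ?S" using True by blast
      ultimately show ?thesis
        using that Suc by (auto simp: funpow_swap1)
    qed
    have "\<forall>n. \<exists>a. a \<in> P \<and> (F ^^ n) x \<in> a"
      using regular_ex[OF funpow_regular[OF x(2)]] by blast
    then obtain a where a: "\<And>n. a n \<in> P" "\<And>n. (F ^^ n) x \<in> a n"
      by metis
    let ?R = "space M \<inter> (\<Inter>i. (F ^^ i) -` a i)"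
    have R: "?R \<in> refinement M F P UNIV"
      unfolding refinement_def using a(1) by auto
    have xR: "x \<in> ?R" and yR: "y \<in> ?R"
      using a(2) sym[OF a] x(2) y(2) regular_subset by auto
    have "\<forall>A\<in>refinement M F P UNIV. A \<noteq> {} \<longrightarrow> is_singleton A"
      using wgm by (simp add: weak_gibbs_markov_def WGM_separability_def)
    from bspec[OF this R] have "is_singleton ?R"
      using xR by auto
    then have "x = y"
      using xR yR by (metis is_singletonE singletonD)
    then show ?thesis
      using Jp C \<beta> by simp
  next
    case False
    then obtain n0 where "n0 \<in> ?S" by blast
    then have "(INF n\<in>?S. enat n) \<in> enat ` ?S"
      by (intro wellorder_InfI[of "enat n0"] imageI)
    then obtain n where n: "n \<in> ?S" "separation_time F P (F x) (F y) = enat n"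
      unfolding separation_time_def by blast
    have "k \<le> n"
    proof (rule ccontr)
      assume "\<not> k \<le> n"
      then have "n < k" by simp
      obtain a b where ab: "a \<in> P" "b \<in> P" "a \<noteq> b" "(F ^^ n) (F x) \<in> a" "(F ^^ n) (F y) \<in> b"
        using n(1) by blast
      then have "(F ^^ n) (F x) \<in> b"
        using same \<open>n < k\<close> unfolding same_itinerary_def by blast
      then show False
        using regular_unique[OF funpow_regular[OF F_regular[OF x(2)]]] ab by blast
    qed
    have "ln (J x / J y) \<le> C * \<beta> ^ n"
      by (rule gibbs[OF w x(1) y(1) n(2)])
    also have "\<dots> \<le> C * \<beta> ^ k"
      using C \<beta> \<open>k \<le> n\<close> by (intro mult_left_mono power_decreasing) auto
    finally have "J x / J y \<le> exp (C * \<beta> ^ k)"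
      using Jp by (metis divide_pos_pos exp_le_cancel_iff exp_ln)
    then show ?thesis
      using Jp by (simp add: field_simps)
  qed
qed

text \<open>
  Integrate \<open>J x \<le> exp (C \<beta>\<^sup>k) J y\<close> over \<open>x \<in> E\<close> and \<open>y \<in> D\<close>. Comparing two image measures directly
  avoids a change of variables formula for the iterates.
\<close>

lemma distortion_step:
  assumes w: "\<omega> \<in> P" and D: "D \<in> sets M" "D \<subseteq> \<omega> \<inter> regular" and E: "E \<in> sets M" "E \<subseteq> D"
    and same: "\<And>x y. x \<in> D \<Longrightarrow> y \<in> D \<Longrightarrow> same_itinerary k (F x) (F y)"
  shows "measure M (F ` E) * measure M D \<le> exp (C * \<beta> ^ k) * measure M E * measure M (F ` D)"
proof -
  let ?c = "exp (C * \<beta> ^ k)"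
  have J: "J x \<le> ?c * J y" if "x \<in> D" "y \<in> D" for x y
    using that D E w by (intro J_ratio[OF w] same) auto
  have FE: "emeasure M (F ` E) = (\<integral>\<^sup>+x\<in>E. ennreal (J x) \<partial>M)"
    by (rule emeasure_image[OF w E(1)]) (use D E in auto)
  have FD: "emeasure M (F ` D) = (\<integral>\<^sup>+x\<in>D. ennreal (J x) \<partial>M)"
    by (rule emeasure_image[OF w D(1)]) (use D in auto)
  have *: "emeasure M (F ` E) \<le> ennreal ?c * emeasure M E * ennreal (J y)" if y: "y \<in> D" for y
  proof -
    have "(\<integral>\<^sup>+x\<in>E. ennreal (J x) \<partial>M) \<le> (\<integral>\<^sup>+x\<in>E. ennreal (?c * J y) \<partial>M)"
      using J[OF _ y] E(2) by (intro nn_integral_mono) (auto simp: indicator_def intro!: ennreal_leI)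
    also have "\<dots> = ennreal (?c * J y) * emeasure M E"
      using E(1) by (simp add: nn_integral_cmult_indicator)
    also have "ennreal (?c * J y) = ennreal ?c * ennreal (J y)"
      by (rule ennreal_mult') simp
    finally show ?thesis
      unfolding FE by (simp add: mult_ac)
  qed
  have "(\<integral>\<^sup>+y\<in>D. emeasure M (F ` E) \<partial>M)
      \<le> (\<integral>\<^sup>+y\<in>D. (ennreal ?c * emeasure M E) * ennreal (J y) \<partial>M)"
  proof (intro nn_integral_mono)
    fix y
    show "emeasure M (F ` E) * indicator D y \<le> ennreal ?c * emeasure M E * ennreal (J y) * indicator D y"
      using *[of y] by (cases "y \<in> D") simp_all
  qed
  also have "\<dots> = (ennreal ?c * emeasure M E) * emeasure M (F ` D)"
    unfolding FD using D(1) by (subst nn_integral_cmult[symmetric]) (auto simp: mult.assoc)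
  finally have "emeasure M (F ` E) * emeasure M D \<le> ennreal ?c * emeasure M E * emeasure M (F ` D)"
    using D(1) by (simp add: nn_integral_cmult_indicator)
  then show ?thesis
    by (simp add: emeasure_eq_measure ennreal_mult'[symmetric] ennreal_le_iff)
qed

text \<open>
  The factors of the single steps multiply. The first step has the smallest factor, because the images of
  the two points then still share \<open>n - 1\<close> symbols, and the exponents add up to a partial geometric sum,
  bounded independently of \<open>n\<close>.
\<close>

lemma distortion:
  assumes "D \<in> sets M" "D \<subseteq> regular" "E \<in> sets M" "E \<subseteq> D"
    and "\<And>x y. x \<in> D \<Longrightarrow> y \<in> D \<Longrightarrow> same_itinerary n x y"
  shows "(F ^^ n) ` E \<in> sets M \<and> measure M ((F ^^ n) ` E) * measure M D
           \<le> exp (C * (\<Sum>i<n. \<beta> ^ i)) * measure M E * measure M ((F ^^ n) ` D)"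
  using assms
proof (induction n arbitrary: D E)
  case 0
  then show ?case by simp
next
  case (Suc n)
  show ?case
  proof (cases "D = {}")
    case True
    with Suc.prems show ?thesis by simp
  next
    case False
    then obtain x0 where x0: "x0 \<in> D" by auto
    then obtain \<omega> where w: "\<omega> \<in> P" "x0 \<in> \<omega>"
      using regular_ex Suc.prems(2) by blast
    have Dw: "D \<subseteq> \<omega>"
      using Suc.prems(5)[OF x0] w by (auto simp: same_itinerary_Suc)
    have same: "same_itinerary n (F x) (F y)" if "x \<in> D" "y \<in> D" for x y
      using Suc.prems(5)[OF that] by (simp add: same_itinerary_Suc)
    have im: "F ` E \<in> sets M" "F ` D \<in> sets M"
      using Suc.prems Dw by (auto intro!: image_sets[OF w(1)])
    have IH: "(F ^^ n) ` F ` E \<in> sets M \<and>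
      measure M ((F ^^ n) ` F ` E) * measure M (F ` D)
         \<le> exp (C * (\<Sum>i<n. \<beta> ^ i)) * measure M (F ` E) * measure M ((F ^^ n) ` F ` D)"
      by (rule Suc.IH[OF im(2) _ im(1)]) (use Suc.prems(2,4) same F_regular in auto)
    have eq: "(F ^^ Suc n) ` X = (F ^^ n) ` F ` X" for X
      by (simp add: funpow_Suc_right image_comp del: funpow.simps(2))
    let ?a = "measure M ((F ^^ n) ` F ` E)" and ?b = "measure M ((F ^^ n) ` F ` D)"
    let ?K = "exp (C * (\<Sum>i<n. \<beta> ^ i))" and ?k = "exp (C * \<beta> ^ n)"
    have step: "measure M (F ` E) * measure M D \<le> ?k * measure M E * measure M (F ` D)"
      by (rule distortion_step[OF w(1)]) (use Suc.prems Dw same in auto)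
    have K: "exp (C * (\<Sum>i<Suc n. \<beta> ^ i)) = ?K * ?k"
      by (simp add: distrib_left exp_add)
    have "?a * measure M D \<le> ?K * ?k * measure M E * ?b"
    proof (cases "measure M (F ` D) = 0")
      case True
      then have "F ` D \<in> null_sets M"
        using im by (auto simp: null_sets_def emeasure_eq_measure)
      then have "measure M D = 0"
        using image_null_iff[OF w(1) Suc.prems(1) Dw] by (simp add: measure_eq_0_null_sets)
      then show ?thesis by (simp add: measure_nonneg)
    next
      case False
      then have pos: "0 < measure M (F ` D)"
        by (simp add: zero_less_measure_iff)
      have "(?a * measure M D) * measure M (F ` D) = (?a * measure M (F ` D)) * measure M D"
        by simp
      also have "\<dots> \<le> (?K * measure M (F ` E) * ?b) * measure M D"
        using IH by (intro mult_right_mono) auto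
      also have "\<dots> = (?K * ?b) * (measure M (F ` E) * measure M D)"
        by simp
      also have "\<dots> \<le> (?K * ?b) * (?k * measure M E * measure M (F ` D))"
        by (intro mult_left_mono step) auto
      also have "\<dots> = (?K * ?k * measure M E * ?b) * measure M (F ` D)"
        by simp
      \<comment> \<open>cancel the measure of the intermediate image \<open>F(D)\<close>\<close>
      finally show ?thesis
        using pos by (simp only: mult_le_cancel_right_pos)
    qed
    then show ?thesis
      unfolding eq K using IH by simp
  qed
qed


section \<open>The countable family of cylinders\<close>

lemma same_itinerary_mono: "same_itinerary n x y \<Longrightarrow> m \<le> n \<Longrightarrow> same_itinerary m x y"
  by (auto simp: same_itinerary_def)

lemma same_itineraryI:
  assumes x: "x \<in> regular" and y: "y \<in> regular"
    and common: "\<And>i. i < n \<Longrightarrow> \<exists>a\<in>P. (F ^^ i) x \<in> a \<and> (F ^^ i) y \<in> a"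
  shows "same_itinerary n x y"
  unfolding same_itinerary_def
proof (intro allI impI ballI)
  fix i \<omega> assume "i < n" and w: "\<omega> \<in> P"
  obtain a where a: "a \<in> P" "(F ^^ i) x \<in> a" "(F ^^ i) y \<in> a"
    using common[OF \<open>i < n\<close>] by blast
  have "(F ^^ i) x \<in> \<omega> \<longleftrightarrow> a = \<omega>"
    using regular_unique[OF funpow_regular[OF x] a(1) w a(2)] a(2) by blast
  moreover have "(F ^^ i) y \<in> \<omega> \<longleftrightarrow> a = \<omega>"
    using regular_unique[OF funpow_regular[OF y] a(1) w a(3)] a(3) by blast
  ultimately show "(F ^^ i) x \<in> \<omega> \<longleftrightarrow> (F ^^ i) y \<in> \<omega>"
    by simp
qed

lemma sets_itinerary:
  assumes "\<And>i. i < n \<Longrightarrow> a i \<in> P"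
  shows "{y \<in> space M. \<forall>i<n. (F ^^ i) y \<in> a i} \<in> sets M"
  using assms
proof (induction n)
  case (Suc n)
  have "{y \<in> space M. \<forall>i<Suc n. (F ^^ i) y \<in> a i}
      = {y \<in> space M. \<forall>i<n. (F ^^ i) y \<in> a i} \<inter> ((F ^^ n) -` a n \<inter> space M)"
    unfolding All_less_Suc by blast
  also have "\<dots> \<in> sets M"
    using Suc.prems by (intro sets.Int Suc.IH measurable_sets[OF funpow_measurable sets_P]) simp_all
  finally show ?case .
qed simp

lemma sets_cylinder [measurable]:
  assumes x: "x \<in> regular"
  shows "cylinder n x \<in> sets M"
proof -
  have "\<forall>i. \<exists>a. a \<in> P \<and> (F ^^ i) x \<in> a"
    using regular_ex[OF funpow_regular[OF x]] by blast
  then obtain a where a: "\<And>i. a i \<in> P" "\<And>i. (F ^^ i) x \<in> a i"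
    by metis
  have "y \<in> cylinder n x \<longleftrightarrow> y \<in> regular \<and> (\<forall>i<n. (F ^^ i) y \<in> a i)" for y
  proof
    assume "y \<in> cylinder n x"
    then show "y \<in> regular \<and> (\<forall>i<n. (F ^^ i) y \<in> a i)"
      using a unfolding cylinder_def same_itinerary_def by blast
  next
    assume y: "y \<in> regular \<and> (\<forall>i<n. (F ^^ i) y \<in> a i)"
    then have "same_itinerary n x y"
      by (intro same_itineraryI x bexI[of _ "a _"]) (auto simp: a)
    with y show "y \<in> cylinder n x"
      unfolding cylinder_def by blast
  qed
  then have "cylinder n x = regular \<inter> {y \<in> space M. \<forall>i<n. (F ^^ i) y \<in> a i}"
    using regular_subset by auto
  also have "\<dots> \<in> sets M"
    by (intro sets.Int sets_regular sets_itinerary a)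
  finally show ?thesis .
qed

lemma cylinder_cong: "same_itinerary n x y \<Longrightarrow> cylinder n x = cylinder n y"
  by (simp add: cylinder_def same_itinerary_def)

text \<open>
  A cylinder is determined by a word of length \<open>n\<close> in the countable alphabet \<open>P\<close>.
\<close>

lemma countable_cylinders: "countable (cylinder n ` regular)"
proof -
  let ?code = "\<lambda>x. restrict (\<lambda>i. SOME a. a \<in> P \<and> (F ^^ i) x \<in> a) {..<n}"
  have some: "(SOME a. a \<in> P \<and> (F ^^ i) x \<in> a) \<in> P \<and> (F ^^ i) x \<in> (SOME a. a \<in> P \<and> (F ^^ i) x \<in> a)"
    if "x \<in> regular" for x i
    by (rule someI_ex) (use regular_ex[OF funpow_regular[OF that]] in blast)
  have "?code ` regular \<subseteq> PiE {..<n} (\<lambda>_. P)"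
    using some by auto
  moreover have "countable (PiE {..<n} (\<lambda>_. P))"
    by (intro countable_PiE countable_P) auto
  ultimately have *: "countable (?code ` regular)"
    by (rule countable_subset)
  have same: "same_itinerary n x y" if xy: "x \<in> regular" "y \<in> regular" and eq: "?code x = ?code y" for x y
  proof (rule same_itineraryI[OF xy])
    fix i assume "i < n"
    let ?a = "SOME a. a \<in> P \<and> (F ^^ i) x \<in> a"
    have "?a = (SOME a. a \<in> P \<and> (F ^^ i) y \<in> a)"
      using fun_cong[OF eq, of i] \<open>i < n\<close> by simp
    then have "?a \<in> P" "(F ^^ i) x \<in> ?a" "(F ^^ i) y \<in> ?a"
      using some[OF xy(1), of i] some[OF xy(2), of i] by auto
    then show "\<exists>a\<in>P. (F ^^ i) x \<in> a \<and> (F ^^ i) y \<in> a"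
      by blast
  qed
  have cong: "cylinder n x = cylinder n y" if "x \<in> regular" "y \<in> regular" "?code x = ?code y" for x y
    by (intro cylinder_cong same that)
  have "cylinder n ` regular
      = (\<lambda>c. cylinder n (SOME x. x \<in> regular \<and> ?code x = c)) ` ?code ` regular"
  proof -
    have "cylinder n x = cylinder n (SOME z. z \<in> regular \<and> ?code z = ?code x)" if "x \<in> regular" for x
    proof -
      have "(SOME z. z \<in> regular \<and> ?code z = ?code x) \<in> regular
          \<and> ?code (SOME z. z \<in> regular \<and> ?code z = ?code x) = ?code x"
        by (rule someI_ex) (use that in blast)
      then show ?thesis
        by (intro cong that) auto
    qed
    then show ?thesis
      unfolding image_image by (intro image_cong refl)
  qed
  then show ?thesis
    using * by simp
qed

section \<open>Measurable sets are nearly unions of cylinders\<close>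

text \<open>
  Only the regular part of \<open>U\<close> is required to be a union of cylinders of depth \<open>n\<close>; this gives an
  increasing sequence of algebras without any \<open>mod 0\<close>.
\<close>

definition determined_by :: "nat \<Rightarrow> 'a set \<Rightarrow> bool" where
  "determined_by n U \<longleftrightarrow> U \<in> sets M \<and>
     (\<forall>x\<in>regular. \<forall>y\<in>regular. same_itinerary n x y \<longrightarrow> (x \<in> U \<longleftrightarrow> y \<in> U))"

lemma determined_by_mono: "determined_by m U \<Longrightarrow> m \<le> n \<Longrightarrow> determined_by n U"
  unfolding determined_by_def using same_itinerary_mono by blast

lemma determined_by_refinement:
  assumes "U \<in> refinement M F P {..<n}"
  shows "determined_by n U"
proof -
  obtain w where w: "\<forall>i\<in>{..<n}. w i \<in> P" "U = space M \<inter> (\<Inter>i\<in>{..<n}. (F ^^ i) -` w i)"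
    using assms by (auto simp: refinement_def)
  then have "U = {y \<in> space M. \<forall>i<n. (F ^^ i) y \<in> w i}"
    by auto
  also have "\<dots> \<in> sets M"
    using w(1) by (intro sets_itinerary) auto
  finally have "U \<in> sets M" .
  moreover have "x \<in> U \<longleftrightarrow> y \<in> U" if "x \<in> regular" "y \<in> regular" "same_itinerary n x y" for x y
    using that w regular_subset by (auto simp: same_itinerary_def)
  ultimately show ?thesis
    unfolding determined_by_def by blast
qed

definition approximable :: "'a set \<Rightarrow> bool" where
  "approximable B \<longleftrightarrow> B \<in> sets M \<and>
     (\<forall>\<epsilon>>0. \<exists>n U. determined_by n U \<and> measure M (sym_diff B U) < \<epsilon>)"

text \<open>
  Replace the union by a finite one up to \<open>\<epsilon> / 2\<close>, and approximate each of the finitely many sets by a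
  set determined by finitely many symbols. The sum of these depths is a depth that serves for all of them.
\<close>

lemma approximable_Union:
  assumes B: "\<And>i::nat. approximable (B i)"
  shows "approximable (\<Union>i. B i)"
  unfolding approximable_def
proof (intro conjI allI impI)
  show sB: "(\<Union>i. B i) \<in> sets M"
    using B by (auto simp: approximable_def)
  fix \<epsilon> :: real assume \<epsilon>: "0 < \<epsilon>"
  have Bs: "B i \<in> sets M" for i
    using B by (auto simp: approximable_def)
  have "(\<lambda>N. measure M (\<Union>i<N. B i)) \<longlonglongrightarrow> measure M (\<Union>N. \<Union>i<N. B i)"
    using Bs by (intro finite_Lim_measure_incseq) (auto simp: incseq_def intro: less_le_trans)
  moreover have "(\<Union>N. \<Union>i<N. B i) = (\<Union>i. B i)"
    by auto
  ultimately have "\<forall>\<^sub>F N in sequentially. measure M (\<Union>i. B i) - \<epsilon> / 2 < measure M (\<Union>i<N. B i)"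
    using \<epsilon> by (intro order_tendstoD(1)[where y = "measure M (\<Union>i. B i)"]) auto
  then obtain N where N: "measure M (\<Union>i. B i) - \<epsilon> / 2 < measure M (\<Union>i<N. B i)"
    by (auto simp: eventually_sequentially)
  let ?\<delta> = "\<epsilon> / (2 * (real N + 1))"
  have "\<forall>i. \<exists>n U. determined_by n U \<and> measure M (sym_diff (B i) U) < ?\<delta>"
    using B \<epsilon> unfolding approximable_def by auto
  then obtain n U where U: "\<And>i. determined_by (n i) (U i)" "\<And>i. measure M (sym_diff (B i) (U i)) < ?\<delta>"
    by metis
  have Us: "U i \<in> sets M" for i
    using U(1) by (auto simp: determined_by_def)
  have "determined_by (\<Sum>i<N. n i) (U i)" if "i < N" for i
    by (rule determined_by_mono[OF U(1)]) (use that in \<open>auto intro!: member_le_sum\<close>)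
  then have "determined_by (\<Sum>i<N. n i) (\<Union>i<N. U i)"
    using Us unfolding determined_by_def by (auto; blast)
  moreover have "measure M (sym_diff (\<Union>i. B i) (\<Union>i<N. U i)) < \<epsilon>"
  proof -
    have "measure M (sym_diff (\<Union>i. B i) (\<Union>i<N. U i))
        \<le> measure M (((\<Union>i. B i) - (\<Union>i<N. B i)) \<union> (\<Union>i<N. sym_diff (B i) (U i)))"
      using Bs Us by (intro finite_measure_mono) auto
    also have "\<dots> \<le> measure M ((\<Union>i. B i) - (\<Union>i<N. B i)) + measure M (\<Union>i<N. sym_diff (B i) (U i))"
      using Bs Us by (intro measure_Un_le) auto
    also have "measure M ((\<Union>i. B i) - (\<Union>i<N. B i)) = measure M (\<Union>i. B i) - measure M (\<Union>i<N. B i)"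
      using Bs by (intro finite_measure_Diff) auto
    also have "measure M (\<Union>i<N. sym_diff (B i) (U i)) \<le> (\<Sum>i<N. measure M (sym_diff (B i) (U i)))"
      using Bs Us by (intro finite_measure_subadditive_finite) auto
    also have "\<dots> \<le> (\<Sum>i<N. ?\<delta>)"
      by (intro sum_mono less_imp_le U)
    also have "\<dots> \<le> \<epsilon> / 2"
      using \<epsilon> by (simp add: field_simps)
    finally show ?thesis
      using N by simp
  qed
  ultimately show "\<exists>n U. determined_by n U \<and> measure M (sym_diff (\<Union>i. B i) U) < \<epsilon>"
    by blast
qed

lemma approximable_sigma_sets:
  assumes "B \<in> sigma_sets (space M) (\<Union>n. refinement M F P {..<n})"
  shows "approximable B"
  using assms
proof induction
  case (Basic a)
  then obtain n where "determined_by n a"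
    using determined_by_refinement by blast
  then show ?case
    unfolding approximable_def by (auto simp: determined_by_def intro!: exI[of _ n] exI[of _ a])
next
  case Empty
  have "determined_by 0 {}"
    by (simp add: determined_by_def)
  then show ?case
    unfolding approximable_def by (auto intro!: exI[of _ 0] exI[of _ "{}"])
next
  case (Compl a)
  show ?case
    unfolding approximable_def
  proof (intro conjI allI impI)
    show "space M - a \<in> sets M"
      using Compl by (auto simp: approximable_def)
    fix \<epsilon> :: real assume "0 < \<epsilon>"
    then obtain n U where U: "determined_by n U" "measure M (sym_diff a U) < \<epsilon>"
      using Compl by (auto simp: approximable_def)
    have "a \<subseteq> space M" "U \<subseteq> space M"
      using Compl U by (auto simp: approximable_def determined_by_def dest: sets.sets_into_space)
    then have "sym_diff (space M - a) (space M - U) = sym_diff a U"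
      by auto
    moreover have "determined_by n (space M - U)"
      using U(1) regular_subset by (auto simp: determined_by_def)
    ultimately show "\<exists>n U. determined_by n U \<and> measure M (sym_diff (space M - a) U) < \<epsilon>"
      using U(2) by metis
  qed
next
  case (Union a)
  then show ?case by (intro approximable_Union)
qed

lemma approximable_sets:
  assumes A: "A \<in> sets M"
  shows "approximable A"
  unfolding approximable_def
proof (intro conjI allI impI)
  fix \<epsilon> :: real assume \<epsilon>: "0 < \<epsilon>"
  have "\<forall>A\<in>sets M. \<exists>B\<in>sigma_sets (space M) (\<Union>n. refinement M F P {..<n}). eq_mod0 M A B"
    using wgm by (simp add: weak_gibbs_markov_def WGM_separability_def)
  then obtain B where "approximable B" and null: "sym_diff A B \<in> null_sets M"
    using A approximable_sigma_sets by (auto simp: eq_mod0_def)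
  then obtain n U where U: "determined_by n U" "measure M (sym_diff B U) < \<epsilon>"
    and sets: "U \<in> sets M" "B \<in> sets M"
    using \<epsilon> by (auto simp: approximable_def determined_by_def)
  have "measure M (sym_diff A U) \<le> measure M (sym_diff A B \<union> sym_diff B U)"
    using A sets by (intro finite_measure_mono) auto
  also have "\<dots> \<le> measure M (sym_diff A B) + measure M (sym_diff B U)"
    using A sets by (intro measure_Un_le) auto
  also have "measure M (sym_diff A B) = 0"
    using null by (rule measure_eq_0_null_sets)
  finally show "\<exists>n U. determined_by n U \<and> measure M (sym_diff A U) < \<epsilon>"
    using U by (intro exI[of _ n] exI[of _ U]) auto
qed (rule A)

lemma emeasure_determined_by:
  assumes U: "determined_by n U" and A: "A \<in> sets M"
  shows "emeasure M (U \<inter> A)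
    = (\<integral>\<^sup>+K. emeasure M (K \<inter> A) \<partial>count_space (cylinder n ` (U \<inter> regular)))"
proof -
  have cty: "countable (cylinder n ` (U \<inter> regular))"
    by (rule countable_subset[OF _ countable_cylinders]) auto
  have eq: "U \<inter> regular = (\<Union>K\<in>cylinder n ` (U \<inter> regular). K)"
  proof (intro equalityI subsetI)
    fix x assume "x \<in> U \<inter> regular"
    then have "x \<in> cylinder n x"
      by (simp add: cylinder_def same_itinerary_def)
    then show "x \<in> (\<Union>K\<in>cylinder n ` (U \<inter> regular). K)"
      using \<open>x \<in> U \<inter> regular\<close> by blast
  qed (use U in \<open>auto simp: determined_by_def cylinder_def\<close>)
  have "emeasure M (U \<inter> A) = emeasure M (\<Union>K\<in>cylinder n ` (U \<inter> regular). K \<inter> A)"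
  proof (rule emeasure_eq_AE)
    show "AE x in M. x \<in> U \<inter> A \<longleftrightarrow> x \<in> (\<Union>K\<in>cylinder n ` (U \<inter> regular). K \<inter> A)"
      using AE_regular
    proof eventually_elim
      case (elim x)
      then have "x \<in> U \<longleftrightarrow> x \<in> (\<Union>K\<in>cylinder n ` (U \<inter> regular). K)"
        unfolding eq[symmetric] by blast
      then show ?case by blast
    qed
    show "U \<inter> A \<in> sets M"
      using U A by (auto simp: determined_by_def)
    show "(\<Union>K\<in>cylinder n ` (U \<inter> regular). K \<inter> A) \<in> sets M"
      using A sets_cylinder by (intro sets.countable_UN'[OF cty]) auto
  qed
  also have "\<dots> = (\<integral>\<^sup>+K. emeasure M (K \<inter> A) \<partial>count_space (cylinder n ` (U \<inter> regular)))"
  proof (rule emeasure_UN_countable[OF _ cty])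
    show "K \<inter> A \<in> sets M" if "K \<in> cylinder n ` (U \<inter> regular)" for K
      using that A sets_cylinder by auto
    have disj: "K = L" if KL: "K \<in> cylinder n ` (U \<inter> regular)" "L \<in> cylinder n ` (U \<inter> regular)"
      and z: "z \<in> K" "z \<in> L" for K L z
    proof -
      obtain x y where "K = cylinder n x" "L = cylinder n y"
        using KL by blast
      then show ?thesis
        using cylinder_cong[of n x z] cylinder_cong[of n y z] z by (simp add: cylinder_def)
    qed
    show "disjoint_family_on (\<lambda>K. K \<inter> A) (cylinder n ` (U \<inter> regular))"
      unfolding disjoint_family_on_def using disj by blast
  qed
  finally show ?thesis .
qed

text \<open>
  This replaces the Lebesgue density theorem. If \<open>A\<close> missed more than the proportion \<open>\<epsilon>\<close> of each
  cylinder of positive measure, then it would miss at least the proportion \<open>\<epsilon>\<close> of every union \<open>U\<close> of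
  cylinders of equal depth, in particular of one that approximates \<open>A\<close> itself.
\<close>

lemma ex_full_cylinder:
  assumes A: "A \<in> sets M" "measure M A > 0" and \<epsilon>: "0 < \<epsilon>"
  shows "\<exists>n. \<exists>x\<in>regular. 0 < measure M (cylinder (Suc n) x) \<and>
    measure M (cylinder (Suc n) x - A) \<le> \<epsilon> * measure M (cylinder (Suc n) x)"
proof (rule ccontr)
  assume contra: "\<not> ?thesis"
  \<comment> \<open>The solution of \<open>\<epsilon> (m(A) - \<eta>) = \<eta>\<close>: an approximation better than \<open>\<eta>\<close> is contradictory.\<close>
  define \<eta> where "\<eta> = \<epsilon> * measure M A / (1 + \<epsilon>)"
  have "0 < \<eta>"
    using A \<epsilon> by (simp add: \<eta>_def)
  then obtain n0 U where "determined_by n0 U" and close: "measure M (sym_diff A U) < \<eta>"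
    using approximable_sets[OF A(1)] by (auto simp: approximable_def)
  then have U: "determined_by (Suc n0) U"
    by (auto intro: determined_by_mono)
  then have Us: "U \<in> sets M"
    by (simp add: determined_by_def)
  have *: "ennreal \<epsilon> * emeasure M (K \<inter> space M) \<le> emeasure M (K \<inter> (space M - A))"
    if K: "K \<in> cylinder (Suc n0) ` (U \<inter> regular)" for K
  proof -
    obtain x where x: "x \<in> regular" "K = cylinder (Suc n0) x"
      using K by blast
    have "\<epsilon> * measure M K \<le> measure M (K - A)"
    proof (cases "measure M K = 0")
      case False
      then have "0 < measure M K"
        by (simp add: zero_less_measure_iff)
      then show ?thesis
        using contra x by (meson linear)
    qed (simp add: measure_nonneg)
    moreover have "K \<inter> space M = K" "K \<inter> (space M - A) = K - A"
      using sets.sets_into_space[OF sets_cylinder[OF x(1), of "Suc n0"]] x by auto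
    ultimately show ?thesis
      using \<epsilon> by (simp add: emeasure_eq_measure ennreal_mult'[symmetric])
  qed
  have "ennreal \<epsilon> * emeasure M (U \<inter> space M) \<le> emeasure M (U \<inter> (space M - A))"
    unfolding emeasure_determined_by[OF U sets.top]
      emeasure_determined_by[OF U sets.compl_sets[OF A(1)]]
    by (subst nn_integral_cmult[symmetric]) (auto intro!: nn_integral_mono *)
  moreover have "U \<inter> space M = U" "U \<inter> (space M - A) = U - A"
    using sets.sets_into_space[OF Us] by auto
  ultimately have "\<epsilon> * measure M U \<le> measure M (U - A)"
    using \<epsilon> by (simp add: emeasure_eq_measure ennreal_mult'[symmetric])
  moreover have "measure M (U - A) < \<eta>"
    using A Us by (intro le_less_trans[OF finite_measure_mono close]) auto
  moreover have "measure M A \<le> measure M (U \<union> sym_diff A U)"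
    using A Us by (intro finite_measure_mono) auto
  then have "measure M A \<le> measure M U + measure M (sym_diff A U)"
    using A Us by (intro order_trans[OF _ measure_Un_le]) auto
  then have "measure M A - \<eta> < measure M U"
    using close by simp
  ultimately have "\<epsilon> * (measure M A - \<eta>) < \<eta>"
    using \<epsilon> by (smt (verit) mult_strict_left_mono)
  then show False
    using \<epsilon> by (simp add: \<eta>_def field_simps)
qed

section \<open>Images of cylinders\<close>

text \<open>
  \<open>F\<^sup>n\<^sup>+\<^sup>1\<close> maps the cylinder of depth \<open>n + 1\<close> around \<open>x\<close> onto almost all of \<open>F(\<omega>)\<close>, where \<open>\<omega>\<close> is the last
  symbol: by the Markov property each branch covers the next element of the itinerary completely. The
  statement transports predicates instead of sets, which makes the induction a composition of branches.
\<close>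

lemma AE_cylinder_image:
  assumes "x \<in> regular" "\<omega> \<in> P" "(F ^^ n) x \<in> \<omega>"
    and "AE y in M. y \<in> cylinder (Suc n) x \<longrightarrow> Q ((F ^^ Suc n) y)"
  shows "AE z in M. z \<in> F ` \<omega> \<longrightarrow> Q z"
  using assms
proof (induction n arbitrary: x)
  case 0
  have "y \<in> cylinder (Suc 0) x" if "y \<in> regular" "y \<in> \<omega>" for y
  proof -
    have "same_itinerary (Suc 0) x y"
      using that "0.prems"(2,3) by (intro same_itineraryI[OF \<open>x \<in> regular\<close>] bexI[of _ \<omega>]) auto
    then show ?thesis
      using that(1) by (simp add: cylinder_def)
  qed
  then show ?case
  proof (intro AE_on_image[OF \<open>\<omega> \<in> P\<close>])
    assume cyl: "\<And>y. y \<in> regular \<Longrightarrow> y \<in> \<omega> \<Longrightarrow> y \<in> cylinder (Suc 0) x"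
    show "AE y in M. y \<in> \<omega> \<longrightarrow> Q (F y)"
      using AE_regular "0.prems"(4)
    proof eventually_elim
      case (elim y)
      with cyl[of y] show ?case by simp
    qed
  qed
next
  case (Suc n)
  obtain a where a: "a \<in> P" "x \<in> a"
    using regular_ex[OF Suc.prems(1)] by blast
  obtain b where b: "b \<in> P" "F x \<in> b"
    using regular_ex[OF F_regular[OF Suc.prems(1)]] by blast
  have sub: "b - F ` a \<in> null_sets M"
    by (intro transition_imp_subset a b regular_transition[OF Suc.prems(1)])
  have cyl: "y \<in> cylinder (Suc (Suc n)) x" if "y \<in> regular" "y \<in> a" "F y \<in> cylinder (Suc n) (F x)" for y
  proof -
    have "same_itinerary (Suc 0) x y"
      using a that(2) by (intro same_itineraryI[OF Suc.prems(1) that(1)] bexI[of _ a]) auto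
    then have "\<forall>\<omega>\<in>P. x \<in> \<omega> \<longleftrightarrow> y \<in> \<omega>"
      by (simp add: same_itinerary_Suc)
    then show ?thesis
      using that unfolding cylinder_def same_itinerary_Suc[of "Suc n"] by simp
  qed
  have "AE y in M. y \<in> a \<longrightarrow> (F y \<in> cylinder (Suc n) (F x) \<longrightarrow> Q ((F ^^ Suc n) (F y)))"
    using AE_regular Suc.prems(4)
  proof eventually_elim
    case (elim y)
    then show ?case
      using cyl[of y] by (simp add: funpow_swap1)
  qed
  from AE_on_image[OF a(1) this]
  have "AE y in M. y \<in> F ` a \<longrightarrow> (y \<in> cylinder (Suc n) (F x) \<longrightarrow> Q ((F ^^ Suc n) y))" .
  moreover have "AE y in M. y \<notin> b - F ` a"
    using sub by (rule AE_not_in)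
  ultimately have "AE y in M. y \<in> cylinder (Suc n) (F x) \<longrightarrow> Q ((F ^^ Suc n) y)"
  proof eventually_elim
    case (elim y)
    moreover have "y \<in> b" if "y \<in> cylinder (Suc n) (F x)"
      using that b by (auto simp: cylinder_def same_itinerary_Suc)
    ultimately show ?case by blast
  qed
  then show ?case
    using Suc.IH[OF F_regular[OF Suc.prems(1)] Suc.prems(2)] Suc.prems(3)
    by (simp add: funpow_swap1)
qed

text \<open>
  Here the long branches enter. Finitely many elements fill the space up to less than \<open>\<delta>\<close>, so an image of
  measure at least \<open>\<delta>\<close> meets one of them in positive measure.
\<close>

lemma finite_transition_targets:
  "\<exists>P'. finite P' \<and> P' \<subseteq> P \<and> (\<forall>a\<in>P. \<exists>b\<in>P'. transition a b)"
proof -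
  obtain \<delta> :: real where \<delta>: "0 < \<delta>" "\<And>a. a \<in> P \<Longrightarrow> ennreal \<delta> \<le> emeasure M (F ` a)"
    using wgm by (auto simp: weak_gibbs_markov_def WGM_long_branches_def)
  have "P \<noteq> {}"
    using wgm compl_P_null by (auto simp: weak_gibbs_markov_def)
  define A where "A = (\<lambda>n::nat. space M - (\<Union>i<n. from_nat_into P i))"
  have A: "range A \<subseteq> sets M"
    using sets_P from_nat_into[OF \<open>P \<noteq> {}\<close>] by (auto simp: A_def)
  have "decseq A"
    by (auto simp: A_def decseq_def intro: less_le_trans)
  with A have "(\<lambda>n. measure M (A n)) \<longlonglongrightarrow> measure M (\<Inter>n. A n)"
    by (intro finite_Lim_measure_decseq)
  moreover have "(\<Inter>n. A n) = space M - \<Union>P"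
  proof -
    have "\<Union>P = (\<Union>i. from_nat_into P i)"
      using range_from_nat_into[OF \<open>P \<noteq> {}\<close> countable_P] by simp
    then show ?thesis
      unfolding A_def by auto
  qed
  then have "measure M (\<Inter>n. A n) = 0"
    using compl_P_null by (simp add: measure_eq_0_null_sets)
  ultimately have "\<forall>\<^sub>F n in sequentially. measure M (A n) < \<delta>"
    using \<delta>(1) by (intro order_tendstoD(2)[where y = 0]) auto
  then obtain n where n: "measure M (A n) < \<delta>"
    by (auto simp: eventually_sequentially)
  show ?thesis
  proof (intro exI[of _ "from_nat_into P ` {..<n}"] conjI ballI)
    show "from_nat_into P ` {..<n} \<subseteq> P"
      using from_nat_into[OF \<open>P \<noteq> {}\<close>] by auto
    fix a assume a: "a \<in> P"
    show "\<exists>b\<in>from_nat_into P ` {..<n}. transition a b"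
    proof (rule ccontr)
      assume "\<not> ?thesis"
      then have "F ` a \<inter> b \<in> null_sets M" if "b \<in> from_nat_into P ` {..<n}" for b
        using that image_P_sets[OF a] sets_P from_nat_into[OF \<open>P \<noteq> {}\<close>]
        by (auto simp: transition_def null_sets_def)
      then have "(\<Union>b\<in>from_nat_into P ` {..<n}. F ` a \<inter> b) \<in> null_sets M"
        by (intro null_sets_UN') auto
      then have "emeasure M (A n \<union> (\<Union>b\<in>from_nat_into P ` {..<n}. F ` a \<inter> b)) = emeasure M (A n)"
        using A by (intro emeasure_Un_null_set) auto
      moreover have "emeasure M (F ` a) \<le> emeasure M (A n \<union> (\<Union>b\<in>from_nat_into P ` {..<n}. F ` a \<inter> b))"
        using A image_P_sets[OF a] sets.sets_into_space[OF image_P_sets[OF a]] sets_P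
          from_nat_into[OF \<open>P \<noteq> {}\<close>]
        by (intro emeasure_mono) (auto simp: A_def)
      ultimately have "ennreal \<delta> \<le> emeasure M (A n)"
        using \<delta>(2)[OF a] by simp
      then show False
        using n by (simp add: emeasure_eq_measure ennreal_le_iff)
    qed
  qed auto
qed

text \<open>
  \<open>W\<close> stands for a set whose preimage in the cylinder is the part that misses \<open>A\<close>. It is quantified after
  the cylinder, since one cylinder has to serve the sets \<open>W\<close> of all delays at once.
\<close>

lemma small_on_target:
  assumes A: "A \<in> sets M" "measure M A > 0" and \<epsilon>: "0 < \<epsilon>"
  shows "\<exists>a\<in>P. \<exists>n. \<exists>x\<in>regular. \<forall>W\<in>sets M. \<forall>b\<in>P. transition a b
       \<longrightarrow> (\<forall>y\<in>cylinder (Suc n) x. y \<in> A \<longleftrightarrow> (F ^^ Suc n) y \<notin> W)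
       \<longrightarrow> measure M (W \<inter> b) \<le> \<epsilon>"
proof -
  \<comment> \<open>\<open>c\<close> bounds the distortion at every depth; \<open>d\<close> also absorbs the measure of the image.\<close>
  define c where "c = exp (C * (1 / (1 - \<beta>)))"
  define d where "d = c * measure M (space M)"
  have "0 < measure M (space M)"
    using wgm by (simp add: weak_gibbs_markov_def emeasure_eq_measure)
  then have d: "0 < d"
    by (simp add: d_def c_def)
  have "0 < \<epsilon> / d"
    using \<epsilon> d by simp
  then obtain n x where x: "x \<in> regular" and pos: "0 < measure M (cylinder (Suc n) x)"
    and small: "measure M (cylinder (Suc n) x - A) \<le> (\<epsilon> / d) * measure M (cylinder (Suc n) x)"
    using ex_full_cylinder[OF A] by meson
  obtain a where a: "a \<in> P" "(F ^^ n) x \<in> a"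
    using regular_ex[OF funpow_regular[OF x]] by blast
  let ?K = "cylinder (Suc n) x" and ?G = "F ^^ Suc n"
  have K: "?K \<in> sets M" "?K \<subseteq> regular"
    using sets_cylinder[OF x] by (auto simp: cylinder_def)
  have K_same: "same_itinerary (Suc n) y z" if "y \<in> ?K" "z \<in> ?K" for y z
    using that by (simp add: cylinder_def same_itinerary_def)
  show ?thesis
  proof (intro bexI[OF _ a(1)] exI[of _ n] bexI[OF _ x] ballI impI)
    fix W b assume W: "W \<in> sets M" and b: "b \<in> P" "transition a b"
      and iff: "\<forall>y\<in>?K. y \<in> A \<longleftrightarrow> ?G y \<notin> W"
    have KA: "?K - A \<in> sets M" "?K - A \<subseteq> ?K"
      using K A by auto
    note dist = distortion[OF K KA K_same]
    have GK: "?G ` ?K \<in> sets M"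
      using distortion[OF K K(1) order_refl K_same] by blast
    have "AE z in M. z \<in> F ` a \<longrightarrow> z \<in> ?G ` ?K"
      by (rule AE_cylinder_image[OF x a]) auto
    moreover have "AE z in M. z \<notin> b - F ` a"
      using transition_imp_subset[OF a(1) b] by (rule AE_not_in)
    ultimately have "AE z in M. z \<in> W \<inter> b \<longrightarrow> z \<in> ?G ` (?K - A)"
      by eventually_elim (use iff in auto)
    then have "measure M (W \<inter> b) \<le> measure M (?G ` (?K - A))"
      using dist by (intro finite_measure_mono_AE) auto
    moreover have "measure M (?G ` (?K - A)) * measure M ?K \<le> \<epsilon> * measure M ?K"
    proof -
      have "(\<Sum>i<Suc n. \<beta> ^ i) \<le> 1 / (1 - \<beta>)"
        using \<beta> sum_le_suminf[of "\<lambda>i. \<beta> ^ i" "{..<Suc n}"] by (simp add: suminf_geometric summable_geometric)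
      then have e: "exp (C * (\<Sum>i<Suc n. \<beta> ^ i)) \<le> c"
        unfolding c_def using C by (intro exp_le_cancel_iff[THEN iffD2] mult_left_mono) auto
      have "measure M (?G ` (?K - A)) * measure M ?K
          \<le> exp (C * (\<Sum>i<Suc n. \<beta> ^ i)) * measure M (?K - A) * measure M (?G ` ?K)"
        using dist by blast
      also have "\<dots> \<le> c * ((\<epsilon> / d) * measure M ?K) * measure M (space M)"
        using small \<epsilon> d e by (intro mult_mono bounded_measure) (auto simp: c_def)
      also have "\<dots> = \<epsilon> * measure M ?K"
        using \<open>0 < measure M (space M)\<close> by (simp add: d_def c_def)
      finally show ?thesis .
    qed
    ultimately show "measure M (W \<inter> b) \<le> \<epsilon>"
      using pos by (simp only: mult_le_cancel_right_pos)
  qed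
qed

section \<open>A partition element filled to every precision\<close>

text \<open>
  Inside some cylinder, \<open>A\<close> is carried by an iterate of \<open>F\<close> onto all of \<open>b\<close> except measure \<open>\<epsilon>\<close>. This is
  stated through the sets \<open>W\<close> whose preimage in the cylinder is the complement of \<open>A\<close>, the form in which
  a tail event presents itself.
\<close>

definition nearly_fills :: "'a set \<Rightarrow> 'a set \<Rightarrow> real \<Rightarrow> bool" where
  "nearly_fills A b \<epsilon> \<longleftrightarrow> (\<exists>n. \<exists>x\<in>regular. \<forall>W\<in>sets M.
     (\<forall>y\<in>cylinder (Suc n) x. y \<in> A \<longleftrightarrow> (F ^^ Suc n) y \<notin> W) \<longrightarrow> measure M (W \<inter> b) \<le> \<epsilon>)"

lemma nearly_fills_mono:
  assumes "nearly_fills A b \<epsilon>" "\<epsilon> \<le> \<epsilon>'"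
  shows "nearly_fills A b \<epsilon>'"
proof -
  obtain n x where "x \<in> regular" and small: "\<forall>W\<in>sets M.
     (\<forall>y\<in>cylinder (Suc n) x. y \<in> A \<longleftrightarrow> (F ^^ Suc n) y \<notin> W) \<longrightarrow> measure M (W \<inter> b) \<le> \<epsilon>"
    using assms(1) unfolding nearly_fills_def by (elim exE bexE)
  show ?thesis
    unfolding nearly_fills_def
  proof (intro exI[of _ n] bexI[OF _ \<open>x \<in> regular\<close>] ballI impI)
    fix W assume "W \<in> sets M" "\<forall>y\<in>cylinder (Suc n) x. y \<in> A \<longleftrightarrow> (F ^^ Suc n) y \<notin> W"
    then have "measure M (W \<inter> b) \<le> \<epsilon>"
      using small by blast
    then show "measure M (W \<inter> b) \<le> \<epsilon>'"
      using assms(2) by (rule order_trans)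
  qed
qed

text \<open>
  Each precision is realised by one of finitely many elements; if every one of them failed at some
  precision, then all would fail at the smallest of these.
\<close>

lemma ex_filled_element:
  assumes A: "A \<in> sets M" "measure M A > 0"
  shows "\<exists>b\<in>P. \<forall>\<epsilon>>0. nearly_fills A b \<epsilon>"
proof -
  obtain P' where P': "finite P'" "P' \<subseteq> P" "\<And>a. a \<in> P \<Longrightarrow> \<exists>b\<in>P'. transition a b"
    using finite_transition_targets by blast
  have some: "\<exists>b\<in>P'. nearly_fills A b \<epsilon>" if "0 < \<epsilon>" for \<epsilon>
  proof -
    obtain a n x where a: "a \<in> P" "x \<in> regular"
      and small: "\<forall>W\<in>sets M. \<forall>b\<in>P. transition a b
       \<longrightarrow> (\<forall>y\<in>cylinder (Suc n) x. y \<in> A \<longleftrightarrow> (F ^^ Suc n) y \<notin> W)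
       \<longrightarrow> measure M (W \<inter> b) \<le> \<epsilon>"
      using small_on_target[OF A \<open>0 < \<epsilon>\<close>] by (elim exE bexE)
    obtain b where b: "b \<in> P'" "transition a b"
      using P'(3)[OF a(1)] by blast
    then have "nearly_fills A b \<epsilon>"
      unfolding nearly_fills_def using small a(2) P'(2) by blast
    with b show ?thesis by blast
  qed
  show ?thesis
  proof (rule ccontr)
    assume "\<not> ?thesis"
    then have "\<forall>b\<in>P'. \<exists>\<epsilon>>0. \<not> nearly_fills A b \<epsilon>"
      using P'(2) by blast
    then obtain e where e: "\<And>b. b \<in> P' \<Longrightarrow> 0 < e b" "\<And>b. b \<in> P' \<Longrightarrow> \<not> nearly_fills A b (e b)"
      by metis
    have "0 < Min (insert 1 (e ` P'))"
      using P'(1) e(1) by auto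
    then obtain b where b: "b \<in> P'" "nearly_fills A b (Min (insert 1 (e ` P')))"
      using some by blast
    have "Min (insert 1 (e ` P')) \<le> e b"
      using P'(1) b by simp
    with b e(2) show False
      using nearly_fills_mono by blast
  qed
qed

end


section \<open>Fatou, numerical semigroups and invariant measures\<close>

text \<open>
  Fatou's lemma for indicator functions.
\<close>

lemma emeasure_le_if_eventually_in:
  assumes B: "\<And>k::nat. B k \<in> sets M" and X: "X \<in> sets M"
    and ae: "AE z in M. z \<in> X \<longrightarrow> (\<forall>\<^sub>F k in sequentially. z \<in> B k)"
    and le: "\<And>k. emeasure M (B k) \<le> a"
  shows "emeasure M X \<le> a"
proof -
  have "emeasure M X = (\<integral>\<^sup>+z. indicator X z \<partial>M)"
    using X by simp
  also have "\<dots> \<le> (\<integral>\<^sup>+z. liminf (\<lambda>k. indicator (B k) z) \<partial>M)"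
  proof (rule nn_integral_mono_AE)
    show "AE z in M. (indicator X z :: ennreal) \<le> liminf (\<lambda>k. indicator (B k) z)"
      using ae
    proof eventually_elim
      case (elim z)
      show ?case
      proof (cases "z \<in> X")
        case True
        with elim have "\<forall>\<^sub>F k in sequentially. (1::ennreal) \<le> indicator (B k) z"
          by (auto elim: eventually_mono)
        then have "(1::ennreal) \<le> liminf (\<lambda>k. indicator (B k) z)"
          by (rule Liminf_bounded)
        with True show ?thesis by simp
      qed simp
    qed
  qed
  also have "\<dots> \<le> liminf (\<lambda>k. \<integral>\<^sup>+z. indicator (B k) z \<partial>M)"
    by (rule nn_integral_liminf) (use B in auto)
  also have "\<dots> \<le> liminf (\<lambda>k::nat. a)"
    using B le by (intro Liminf_mono) auto
  also have "\<dots> = a"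
    by (simp add: Liminf_const)
  finally show ?thesis .
qed

text \<open>
  The least positive difference \<open>d\<close> of two elements divides every element, as the remainder of an element
  modulo \<open>d\<close> is again a difference; hence \<open>d = 1\<close> and the semigroup contains some \<open>a\<close> and \<open>a + 1\<close>. A number
  \<open>q a + r\<close> with \<open>r < a \<le> q\<close> is then \<open>r (a + 1) + (q - r) a\<close>.
\<close>

lemma eventually_in_semigroup:
  fixes S :: "nat set"
  assumes zero: "0 \<in> S" and add: "\<And>s t. s \<in> S \<Longrightarrow> t \<in> S \<Longrightarrow> s + t \<in> S" and "Gcd S = 1"
  shows "\<exists>N. \<forall>t\<ge>N. t \<in> S"
proof -
  have mult: "k * s \<in> S" if "s \<in> S" for k s
    by (induction k) (auto intro: zero add that)
  let ?D = "\<lambda>d. 0 < d \<and> (\<exists>s\<in>S. s + d \<in> S)"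
  define d where "d = (LEAST d. ?D d)"
  have "S \<noteq> {0}"
    using \<open>Gcd S = 1\<close> by auto
  then obtain s0 where "s0 \<in> S" "0 < s0"
    using zero by (metis gr0I insertI1 singletonD subsetI subset_antisym subset_singletonD empty_iff)
  then have "?D s0"
    using zero by (intro conjI bexI[of _ 0]) auto
  then have d: "?D d"
    unfolding d_def by (rule LeastI)
  then obtain a where a: "a \<in> S" "a + d \<in> S"
    by blast
  have "d dvd s" if s: "s \<in> S" for s
  proof (rule ccontr)
    assume "\<not> d dvd s"
    then have "0 < s mod d"
      by (simp add: mod_greater_zero_iff_not_dvd)
    have "(s div d) * (a + d) + s mod d = s + (s div d) * a"
      by (simp add: distrib_left add.assoc add.commute[of s])
    also have "\<dots> \<in> S"
      by (intro add mult s a)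
    finally have "?D (s mod d)"
      using \<open>0 < s mod d\<close> mult[OF a(2)] by blast
    then have "d \<le> s mod d"
      unfolding d_def by (rule Least_le)
    then show False
      using d by (metis mod_less_divisor not_le)
  qed
  then have "d dvd Gcd S"
    by (rule Gcd_greatest)
  then have a: "a \<in> S" "a + 1 \<in> S"
    using a \<open>Gcd S = 1\<close> by auto
  have "t \<in> S" if "a * a \<le> t" for t
  proof (cases "a = 0")
    case True
    then show ?thesis
      using mult[OF a(2), of t] by simp
  next
    case False
    define q r where "q = t div a" and "r = t mod a"
    have "r < a" "a \<le> q"
      using False that by (auto simp: q_def r_def less_eq_div_iff_mult_less_eq)
    have "t = q * a + r"
      by (simp add: q_def r_def)
    also have "\<dots> = r * (a + 1) + (q - r) * a"
      using \<open>r < a\<close> \<open>a \<le> q\<close> by (simp add: algebra_simps diff_mult_distrib)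
    also have "\<dots> \<in> S"
      by (intro add mult a)
    finally show ?thesis .
  qed
  then show ?thesis by blast
qed

lemma emeasure_invariant_vimage:
  assumes inv: "invariant_measure \<nu> T" and B: "B \<in> sets \<nu>"
  shows "emeasure \<nu> ((T ^^ n) -` B \<inter> space \<nu>) = emeasure \<nu> B"
proof (induction n)
  case 0
  then show ?case
    using sets.sets_into_space[OF B] by (simp add: Int_absorb2)
next
  case (Suc n)
  have T: "T \<in> \<nu> \<rightarrow>\<^sub>M \<nu>" "distr \<nu> \<nu> T = \<nu>"
    using inv by (auto simp: invariant_measure_def)
  have Tn: "T ^^ n \<in> \<nu> \<rightarrow>\<^sub>M \<nu>"
    by (induction n) (use T(1) in \<open>auto intro: measurable_comp\<close>)
  have "(T ^^ Suc n) -` B \<inter> space \<nu> = T -` ((T ^^ n) -` B \<inter> space \<nu>) \<inter> space \<nu>"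
    using measurable_space[OF T(1)] by (auto simp: funpow_swap1)
  also have "emeasure \<nu> \<dots> = emeasure (distr \<nu> \<nu> T) ((T ^^ n) -` B \<inter> space \<nu>)"
    using measurable_sets[OF Tn B] T(1) by (simp add: emeasure_distr)
  also have "\<dots> = emeasure \<nu> B"
    unfolding T(2) by (rule Suc.IH)
  finally show ?case .
qed

section \<open>The tower\<close>

locale wgm_tower = wgm_map +
  fixes R :: "'a \<Rightarrow> nat"
  assumes R_measurable: "R \<in> M \<rightarrow>\<^sub>M count_space UNIV"
    and R_pos: "\<And>x. x \<in> space M \<Longrightarrow> 0 < R x"
    and R_const: "\<And>\<omega>. \<omega> \<in> P \<Longrightarrow> R constant_on \<omega>"
    and aper: "aperiodic M F P"
    and block: "coprime_block M F P R"
begin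

abbreviation T :: "'a \<times> nat \<Rightarrow> 'a \<times> nat" where "T \<equiv> tower_map F R"

abbreviation tower :: "('a \<times> nat) measure" where "tower \<equiv> tower_measure M R"

lemma space_tower: "z \<in> space tower \<longleftrightarrow> fst z \<in> space M \<and> snd z < R (fst z)"
  by (cases z) (simp add: space_tower_measure tower_space_def)

text \<open>
  This reduces almost everywhere statements on the tower to the levels, so that they can be moved between
  levels with the facts about \<open>F\<close>.
\<close>

lemma AE_tower: "(AE z in tower. Q z) \<longleftrightarrow> (\<forall>l. AE x in M. l < R x \<longrightarrow> Q (x, l))"
proof
  assume "AE z in tower. Q z"
  then obtain N where N: "{z \<in> space tower. \<not> Q z} \<subseteq> N" "N \<in> null_sets tower"
    by (auto simp: eventually_ae_filter)
  show "\<forall>l. AE x in M. l < R x \<longrightarrow> Q (x, l)"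
  proof
    fix l
    have "N \<in> sets tower"
      using N(2) by auto
    then have "{x. (x, l) \<in> N} \<in> sets M"
      by (simp add: sets_tower_measure[OF R_measurable])
    moreover have "(\<Sum>l. emeasure M {x. (x, l) \<in> N}) = 0"
      using N(2) emeasure_tower_measure[OF R_measurable \<open>N \<in> sets tower\<close>] by auto
    then have "emeasure M {x. (x, l) \<in> N} = 0"
      by (simp add: suminf_eq_zero_iff)
    ultimately have "{x. (x, l) \<in> N} \<in> null_sets M"
      by blast
    then show "AE x in M. l < R x \<longrightarrow> Q (x, l)"
      by (rule AE_I') (use N(1) in \<open>auto simp: space_tower\<close>)
  qed
next
  assume "\<forall>l. AE x in M. l < R x \<longrightarrow> Q (x, l)"
  then have "\<forall>l. \<exists>N. N \<in> null_sets M \<and> {x \<in> space M. \<not> (l < R x \<longrightarrow> Q (x, l))} \<subseteq> N"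
    unfolding eventually_ae_filter by blast
  then obtain N where N: "\<And>l. N l \<in> null_sets M"
    "\<And>l. {x \<in> space M. \<not> (l < R x \<longrightarrow> Q (x, l))} \<subseteq> N l"
    by metis
  let ?N = "{(x, l). x \<in> N l \<and> l < R x}"
  have level: "{x. (x, l) \<in> ?N} \<in> null_sets M" for l
  proof -
    have "{x. (x, l) \<in> ?N} = N l \<inter> (R -` {l<..} \<inter> space M)"
      using sets.sets_into_space[OF null_setsD2[OF N(1)[of l]]] by auto
    then show ?thesis
      using measurable_sets[OF R_measurable, of "{l<..}"] N(1) by (simp add: null_set_Int2)
  qed
  have s: "?N \<in> sets tower"
    using level sets.sets_into_space[OF null_setsD2[OF N(1)]]
    by (auto simp: sets_tower_measure[OF R_measurable] tower_space_def null_sets_def subset_iff)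
  then have "?N \<in> null_sets tower"
    using level emeasure_tower_measure[OF R_measurable s] by (auto simp: null_sets_def)
  then show "AE z in tower. Q z"
  proof (rule AE_I')
    show "{z \<in> space tower. \<not> Q z} \<subseteq> ?N"
      using N(2) by (force simp: space_tower)
  qed
qed

lemma T_measurable: "T \<in> tower \<rightarrow>\<^sub>M tower"
  by (rule measurable_tower_map[OF R_measurable R_pos F_measurable])

lemma T_funpow_measurable: "T ^^ n \<in> tower \<rightarrow>\<^sub>M tower"
proof (induction n)
  case (Suc n)
  then show ?case
    unfolding funpow.simps by (rule measurable_comp[OF _ T_measurable])
qed auto

lemma base_measurable: "(\<lambda>x. (x, 0)) \<in> M \<rightarrow>\<^sub>M tower"
proof (rule measurableI)
  fix A assume "A \<in> sets tower"
  then have "A \<subseteq> tower_space M R" "{x. (x, 0) \<in> A} \<in> sets M"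
    by (auto simp: sets_tower_measure[OF R_measurable])
  moreover have "(\<lambda>x. (x, 0)) -` A \<inter> space M = {x. (x, 0) \<in> A}"
    using \<open>A \<subseteq> tower_space M R\<close> by (auto simp: tower_space_def)
  ultimately show "(\<lambda>x. (x, 0)) -` A \<inter> space M \<in> sets M"
    by simp
qed (simp add: space_tower R_pos)

lemma T_climb: "l < R x \<Longrightarrow> (T ^^ l) (x, 0) = (x, l)"
  by (induction l) (auto simp: tower_map_def)

lemma T_return: "0 < R x \<Longrightarrow> (T ^^ R x) (x, 0) = (F x, 0)"
  using T_climb[of "R x - 1" x] by (cases "R x") (auto simp: tower_map_def)

lemma T_returns: "x \<in> space M \<Longrightarrow> (T ^^ (\<Sum>i<n. R ((F ^^ i) x))) (x, 0) = ((F ^^ n) x, 0)"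
proof (induction n)
  case (Suc n)
  have "(T ^^ (\<Sum>i<Suc n. R ((F ^^ i) x))) (x, 0)
      = (T ^^ R ((F ^^ n) x)) ((T ^^ (\<Sum>i<n. R ((F ^^ i) x))) (x, 0))"
    by (simp add: add.commute funpow_add)
  then show ?case
    using Suc T_return[OF R_pos[OF funpow_space]] by simp
qed simp

section \<open>Covering\<close>

text \<open>
  This says that \<open>T\<^sup>t(S)\<close> contains \<open>X\<close> up to a null set, in a nonsingular way: whatever holds almost
  everywhere on \<open>S\<close> after time \<open>t\<close> holds almost everywhere on \<open>X\<close>. Written with predicates, covering composes
  without any discussion of the measurability of images.
\<close>

definition covers :: "nat \<Rightarrow> ('a \<times> nat) set \<Rightarrow> ('a \<times> nat) set \<Rightarrow> bool" where
  "covers t S X \<longleftrightarrow> (\<forall>Q. (AE z in tower. z \<in> S \<longrightarrow> Q ((T ^^ t) z)) \<longrightarrow> (AE z in tower. z \<in> X \<longrightarrow> Q z))"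

lemma covers_0: "covers 0 S S"
  by (simp add: covers_def)

lemma covers_add:
  assumes "covers s S X" "covers t X Y"
  shows "covers (s + t) S Y"
  unfolding covers_def
proof (intro allI impI)
  fix Q assume "AE z in tower. z \<in> S \<longrightarrow> Q ((T ^^ (s + t)) z)"
  then have "AE z in tower. z \<in> S \<longrightarrow> Q ((T ^^ t) ((T ^^ s) z))"
    by (simp add: funpow_add add.commute[of s])
  then have "AE z in tower. z \<in> X \<longrightarrow> Q ((T ^^ t) z)"
    using assms(1)[unfolded covers_def, rule_format, of "\<lambda>z. Q ((T ^^ t) z)"] by blast
  then show "AE z in tower. z \<in> Y \<longrightarrow> Q z"
    using assms(2)[unfolded covers_def, rule_format, of Q] by blast
qed

lemma covers_mono:
  assumes "covers t S X" "S \<subseteq> S'"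
  shows "covers t S' X"
  unfolding covers_def
proof (intro allI impI)
  fix Q assume "AE z in tower. z \<in> S' \<longrightarrow> Q ((T ^^ t) z)"
  then have "AE z in tower. z \<in> S \<longrightarrow> Q ((T ^^ t) z)"
    by eventually_elim (use assms(2) in auto)
  then show "AE z in tower. z \<in> X \<longrightarrow> Q z"
    using assms(1) unfolding covers_def by blast
qed

lemma covers_branch:
  assumes a: "a \<in> P" and sub: "b - F ` a \<in> null_sets M" and x: "x \<in> a"
  shows "covers (R x) (a \<times> {0}) (b \<times> {0})"
  unfolding covers_def
proof (intro allI impI)
  fix Q assume Q: "AE z in tower. z \<in> a \<times> {0} \<longrightarrow> Q ((T ^^ R x) z)"
  have R: "R y = R x" if "y \<in> a" for y
    using R_const[OF a] that x by (auto simp: constant_on_def)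
  have "AE y in M. 0 < R y \<longrightarrow> (y, 0::nat) \<in> a \<times> {0} \<longrightarrow> Q ((T ^^ R x) (y, 0))"
    using spec[OF Q[unfolded AE_tower], of 0] by simp
  then have "AE y in M. y \<in> a \<longrightarrow> Q (F y, 0)"
    using AE_space
  proof eventually_elim
    case (elim y)
    then show ?case
      using T_return[of y] R_pos[of y] R[of y] by auto
  qed
  then have "AE y in M. y \<in> F ` a \<longrightarrow> Q (y, 0)"
    by (rule AE_on_image[OF a])
  moreover have "AE y in M. y \<notin> b - F ` a"
    using sub by (rule AE_not_in)
  ultimately have "AE y in M. y \<in> b \<longrightarrow> Q (y, 0)"
    by eventually_elim auto
  then have "AE y in M. l < R y \<longrightarrow> (y, l) \<in> b \<times> {0} \<longrightarrow> Q (y, l)" for l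
    by (cases "l = 0") auto
  then show "AE z in tower. z \<in> b \<times> {0} \<longrightarrow> Q z"
    unfolding AE_tower by blast
qed

lemma covers_level: "covers l (a \<times> {0}) (a \<times> {l})"
  unfolding covers_def
proof (intro allI impI)
  fix Q assume Q: "AE z in tower. z \<in> a \<times> {0} \<longrightarrow> Q ((T ^^ l) z)"
  have "AE y in M. 0 < R y \<longrightarrow> (y, 0::nat) \<in> a \<times> {0} \<longrightarrow> Q ((T ^^ l) (y, 0))"
    using spec[OF Q[unfolded AE_tower], of 0] by simp
  then have "AE y in M. l < R y \<longrightarrow> (y, l) \<in> a \<times> {l} \<longrightarrow> Q (y, l)"
  proof eventually_elim
    case (elim y)
    then show ?case
      using T_climb[of l y] by auto
  qed
  then have "AE y in M. k < R y \<longrightarrow> (y, k) \<in> a \<times> {l} \<longrightarrow> Q (y, k)" for k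
    by (cases "k = l") auto
  then show "AE z in tower. z \<in> a \<times> {l} \<longrightarrow> Q z"
    unfolding AE_tower by blast
qed

text \<open>
  Every step of a regular orbit is a transition, and the target of a transition is covered.
\<close>

lemma covers_along_orbit:
  assumes "x \<in> regular" "a \<in> P" "x \<in> a" "b \<in> P" "(F ^^ n) x \<in> b"
  shows "\<exists>t. covers t (a \<times> {0}) (b \<times> {0})"
  using assms
proof (induction n arbitrary: x a)
  case 0
  then have "a = b"
    using regular_unique[of x a b] by simp
  then show ?case
    using covers_0 by blast
next
  case (Suc n)
  obtain c where c: "c \<in> P" "F x \<in> c"
    using regular_ex[OF F_regular[OF Suc.prems(1)]] by blast
  have "transition a c"
    by (rule regular_transition[OF Suc.prems(1,2) c(1) Suc.prems(3) c(2)])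
  then have "covers (R x) (a \<times> {0}) (c \<times> {0})"
    by (intro covers_branch transition_imp_subset Suc.prems c)
  moreover obtain t where "covers t (c \<times> {0}) (b \<times> {0})"
    using Suc.IH[OF F_regular[OF Suc.prems(1)] c Suc.prems(4)] Suc.prems(5)
    by (auto simp: funpow_swap1)
  ultimately show ?case
    using covers_add by blast
qed

text \<open>
  A set of positive measure contains a regular point, whose orbit can be followed.
\<close>

lemma covers_irreducible:
  assumes a: "a \<in> P" and b: "b \<in> P"
  shows "\<exists>t. covers t (a \<times> {0}) (b \<times> {0})"
proof -
  obtain n where n: "0 < emeasure M (a \<inter> (F ^^ n) -` b)"
    using aper a b unfolding aperiodic_def by blast
  have "\<exists>x\<in>regular. x \<in> a \<inter> (F ^^ n) -` b"
  proof (rule ccontr)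
    assume "\<not> ?thesis"
    then have "a \<inter> (F ^^ n) -` b \<subseteq> space M - regular"
      using P_subset_space[OF a] by auto
    then have "emeasure M (a \<inter> (F ^^ n) -` b) \<le> emeasure M (space M - regular)"
      by (rule emeasure_mono) auto
    moreover have "space M - regular \<in> null_sets M"
      using AE_regular by (subst AE_iff_null_sets) (auto elim: AE_mp)
    ultimately show False
      using n by (auto simp: null_sets_def)
  qed
  then show ?thesis
    using covers_along_orbit a b by blast
qed

lemma P_nonempty: "a \<in> P \<Longrightarrow> a \<noteq> {}"
  using aper unfolding aperiodic_def by fastforce

text \<open>
  Go from \<open>b\<close> to the first element of the block, spread over the whole block \<open>X\<close>, let \<open>X\<close> cover itself for
  an arbitrary large time, go on to \<open>a\<close> and climb to level \<open>l\<close>. The times at which \<open>X\<close> covers itself form a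
  semigroup that contains the return times of all elements of the block, whose greatest common divisor
  is 1.
\<close>

lemma eventually_covers:
  assumes b: "b \<in> P" and a: "a \<in> P"
  shows "\<exists>N. \<forall>t\<ge>N. covers t (b \<times> {0}) (a \<times> {l})"
proof -
  obtain N :: nat and \<omega> :: "nat \<Rightarrow> 'a set" where N: "2 \<le> N" and \<omega>: "\<And>i. i \<in> {1..N} \<Longrightarrow> \<omega> i \<in> P"
    and gcd: "Gcd (\<Union>i\<in>{1..N}. R ` \<omega> i) = 1"
    and sub: "\<And>i. i \<in> {1..N} \<Longrightarrow> (\<Union>j\<in>{1..N}. \<omega> j) - F ` \<omega> i \<in> null_sets M"
    using block unfolding coprime_block_def by blast
  define X where "X = (\<Union>i\<in>{1..N}. \<omega> i) \<times> {0::nat}"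
  have one: "(1::nat) \<in> {1..N}"
    using N by auto
  have loop: "covers (R x) (\<omega> i \<times> {0}) X" if "i \<in> {1..N}" "x \<in> \<omega> i" for i x
    unfolding X_def by (rule covers_branch[OF \<omega>[OF that(1)] sub[OF that(1)] that(2)])
  \<comment> \<open>One element of the block covers \<open>X\<close> at its own return time; \<open>X\<close> covers itself at all of these times.\<close>
  define S where "S = {t. covers t X X}"
  have "R x \<in> S" if "i \<in> {1..N}" "x \<in> \<omega> i" for i x
  proof -
    have "\<omega> i \<times> {0} \<subseteq> X"
      using that(1) by (auto simp: X_def)
    then show ?thesis
      unfolding S_def using covers_mono[OF loop[OF that]] by blast
  qed
  then have "Gcd S dvd Gcd (\<Union>i\<in>{1..N}. R ` \<omega> i)"
    by (intro Gcd_greatest) (auto intro: Gcd_dvd)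
  then have "Gcd S = 1"
    using gcd by simp
  then obtain t0 where t0: "\<And>t. t0 \<le> t \<Longrightarrow> covers t X X"
    using eventually_in_semigroup[of S] covers_0 covers_add by (auto simp: S_def)
  obtain x where x: "x \<in> \<omega> 1"
    using P_nonempty[OF \<omega>[OF one]] by blast
  obtain s where s: "covers s (b \<times> {0}) (\<omega> 1 \<times> {0})"
    using covers_irreducible[OF b \<omega>[OF one]] by blast
  obtain u where "covers u (\<omega> 1 \<times> {0}) (a \<times> {0})"
    using covers_irreducible[OF \<omega>[OF one] a] by blast
  then have u: "covers u X (a \<times> {0})"
    by (rule covers_mono) (use one in \<open>auto simp: X_def\<close>)
  have late: "covers (s + R x + t + u + l) (b \<times> {0}) (a \<times> {l})" if "t0 \<le> t" for t
    by (rule covers_add[OF covers_add[OF covers_add[OF covers_add[OF s loop[OF one x]] t0[OF that]] u] covers_level])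
  have "covers t (b \<times> {0}) (a \<times> {l})" if "s + R x + t0 + u + l \<le> t" for t
  proof -
    have "t = s + R x + (t - (s + R x + u + l)) + u + l" "t0 \<le> t - (s + R x + u + l)"
      using that by auto
    then show ?thesis
      using late by metis
  qed
  then show ?thesis by blast
qed

section \<open>Exactness\<close>

text \<open>
  Let \<open>l\<close> be a level at which \<open>A\<close> has positive measure, and look at \<open>A\<close> from the base through \<open>T\<^sup>l\<close>. The sets
  \<open>W k K\<close> below collect the base points that are not in \<open>B (t k + K)\<close> after \<open>K + l\<close> steps. As \<open>b\<close> is
  nearly filled, \<open>W k K\<close> is small on \<open>b\<close> for every delay \<open>K\<close>. The set \<open>D K\<close> is the lower limit of the
  sets \<open>B (t k + K)\<close> in \<open>k\<close>; it has measure at most \<open>\<nu>(A)\<close>, contains almost all of \<open>T\<^sup>K\<^sup>+\<^sup>l(b)\<close>, and therefore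
  contains almost all of any given cell of the tower for large \<open>K\<close>.
\<close>

lemma exact:
  assumes sets_\<nu>: "sets \<nu> = sets tower" and "prob_space \<nu>" and inv: "invariant_measure \<nu> T"
    and ac: "absolutely_continuous tower \<nu>"
  shows "exact_measure \<nu> T"
  unfolding exact_measure_def
proof (intro ballI)
  interpret \<nu>: prob_space \<nu> by fact
  have space_\<nu>: "space \<nu> = space tower"
    using sets_\<nu> by (rule sets_eq_imp_space_eq)
  have T_space: "(T ^^ n) z \<in> space \<nu>" if "z \<in> space \<nu>" for n z
    using measurable_space[OF T_funpow_measurable] that by (simp add: space_\<nu>)
  fix A assume "A \<in> (\<Inter>n. {(T ^^ n) -` B \<inter> space \<nu> |B. B \<in> sets \<nu>})"
  then have "\<forall>n. \<exists>B. B \<in> sets \<nu> \<and> A = (T ^^ n) -` B \<inter> space \<nu>"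
    by blast
  then obtain B where B: "\<And>n. B n \<in> sets \<nu>" "\<And>n. A = (T ^^ n) -` B n \<inter> space \<nu>"
    by metis
  have \<nu>_B: "emeasure \<nu> (B n) = emeasure \<nu> A" for n
    using emeasure_invariant_vimage[OF inv B(1)[of n]] B(2)[of n] by simp
  have A: "A \<in> sets \<nu>"
    using B(1)[of 0] sets.sets_into_space[OF B(1)[of 0]] B(2)[of 0] by (simp add: Int_absorb2)
  show "emeasure \<nu> A = 0 \<or> emeasure \<nu> A = 1"
  proof (cases "emeasure \<nu> A = 0")
    case False
    have "\<not> (AE z in tower. z \<notin> A)"
    proof
      assume "AE z in tower. z \<notin> A"
      then have "AE z in \<nu>. z \<notin> A"
        by (rule absolutely_continuous_AE[OF sets_\<nu> ac])
      then show False
        using A False AE_iff_null_sets[OF A] by (auto simp: null_sets_def)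
    qed
    then obtain l where l: "\<not> (AE x in M. l < R x \<longrightarrow> (x, l) \<notin> A)"
      unfolding AE_tower by blast
    define A\<^sub>0 where "A\<^sub>0 = {x \<in> space M. (T ^^ l) (x, 0) \<in> A}"
    have A\<^sub>0: "A\<^sub>0 \<in> sets M"
    proof -
      have "A\<^sub>0 = (\<lambda>x. (T ^^ l) (x, 0)) -` A \<inter> space M"
        by (auto simp: A\<^sub>0_def)
      then show ?thesis
        using measurable_sets[OF measurable_compose[OF base_measurable T_funpow_measurable]] A sets_\<nu>
        by simp
    qed
    have "measure M A\<^sub>0 \<noteq> 0"
    proof
      assume "measure M A\<^sub>0 = 0"
      then have "A\<^sub>0 \<in> null_sets M"
        using A\<^sub>0 by (simp add: null_sets_def emeasure_eq_measure)
      then have "AE x in M. x \<notin> A\<^sub>0"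
        by (rule AE_not_in)
      then have "AE x in M. l < R x \<longrightarrow> (x, l) \<notin> A"
        using AE_space
      proof eventually_elim
        case (elim x)
        then show ?case
          using T_climb[of l x] by (auto simp: A\<^sub>0_def)
      qed
      with l show False by blast
    qed
    then have "0 < measure M A\<^sub>0"
      by (simp add: zero_less_measure_iff)
    then obtain b where b: "b \<in> P" and fills: "\<And>\<epsilon>. 0 < \<epsilon> \<Longrightarrow> nearly_fills A\<^sub>0 b \<epsilon>"
      using ex_filled_element[OF A\<^sub>0] by blast
    have "\<forall>k. \<exists>n x. x \<in> regular \<and> (\<forall>W\<in>sets M.
     (\<forall>y\<in>cylinder (Suc n) x. y \<in> A\<^sub>0 \<longleftrightarrow> (F ^^ Suc n) y \<notin> W) \<longrightarrow> measure M (W \<inter> b) \<le> (1 / 2) ^ k)"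
    proof
      fix k :: nat
      have "(0::real) < (1 / 2) ^ k"
        by simp
      from fills[OF this, unfolded nearly_fills_def] show "\<exists>n x. x \<in> regular \<and> (\<forall>W\<in>sets M.
     (\<forall>y\<in>cylinder (Suc n) x. y \<in> A\<^sub>0 \<longleftrightarrow> (F ^^ Suc n) y \<notin> W) \<longrightarrow> measure M (W \<inter> b) \<le> (1 / 2) ^ k)"
        by (elim exE bexE) (intro exI conjI)
    qed
    then obtain n x where x: "\<And>k. x k \<in> regular"
      and small: "\<And>k. \<forall>W\<in>sets M. (\<forall>y\<in>cylinder (Suc (n k)) (x k). y \<in> A\<^sub>0 \<longleftrightarrow> (F ^^ Suc (n k)) y \<notin> W)
        \<longrightarrow> measure M (W \<inter> b) \<le> (1 / 2) ^ k"
      by metis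
    \<comment> \<open>\<open>Suc (n k)\<close> iterations of \<open>F\<close> on the cylinder are \<open>t k\<close> iterations of \<open>T\<close>, the return times being
      constant on partition elements.\<close>
    define t where "t = (\<lambda>k. \<Sum>i<Suc (n k). R ((F ^^ i) (x k)))"
    have t: "(T ^^ t k) (y, 0) = ((F ^^ Suc (n k)) y, 0)" if y: "y \<in> cylinder (Suc (n k)) (x k)" for k y
    proof -
      have "R ((F ^^ i) (x k)) = R ((F ^^ i) y)" if "i < Suc (n k)" for i
      proof -
        obtain a where a: "a \<in> P" "(F ^^ i) (x k) \<in> a"
          using regular_ex[OF funpow_regular[OF x]] by blast
        then have "(F ^^ i) y \<in> a"
          using y that unfolding cylinder_def same_itinerary_def by blast
        then show ?thesis
          using R_const[OF a(1)] a(2) by (auto simp: constant_on_def)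
      qed
      then have "t k = (\<Sum>i<Suc (n k). R ((F ^^ i) y))"
        unfolding t_def by (intro sum.cong) auto
      then show ?thesis
        using T_returns[of y "Suc (n k)"] y regular_subset by (auto simp: cylinder_def)
    qed
    define W where "W = (\<lambda>k K. {y \<in> space M. (T ^^ (K + l)) (y, 0) \<notin> B (t k + K)})"
    have W: "W k K \<in> sets M" for k K
    proof -
      have "W k K = space M - ((\<lambda>y. (T ^^ (K + l)) (y, 0)) -` B (t k + K) \<inter> space M)"
        by (auto simp: W_def)
      then show ?thesis
        using measurable_sets[OF measurable_compose[OF base_measurable T_funpow_measurable]] B(1) sets_\<nu>
        by auto
    qed
    \<comment> \<open>\<open>T\<^sup>K\<^sup>+\<^sup>l\<close> and \<open>T\<^sup>t\<close> commute, so from the base both orders of waiting lead to the same test for \<open>A\<close>.\<close>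
    have W_small: "measure M (W k K \<inter> b) \<le> (1 / 2) ^ k" for k K
    proof -
      have "y \<in> A\<^sub>0 \<longleftrightarrow> (F ^^ Suc (n k)) y \<notin> W k K" if y: "y \<in> cylinder (Suc (n k)) (x k)" for y
      proof -
        have ys: "y \<in> space M"
          using y regular_subset by (auto simp: cylinder_def)
        then have "(y, 0) \<in> space \<nu>"
          by (simp add: space_\<nu> space_tower R_pos)
        then have "y \<in> A\<^sub>0 \<longleftrightarrow> (T ^^ (t k + K)) ((T ^^ l) (y, 0)) \<in> B (t k + K)"
          using ys T_space[of "(y, 0)" l] B(2)[of "t k + K"] by (auto simp: A\<^sub>0_def)
        also have "(T ^^ (t k + K)) ((T ^^ l) (y, 0)) = (T ^^ (K + l + t k)) (y, 0)"
          by (simp add: funpow_add[symmetric, unfolded o_def, THEN fun_cong] ac_simps)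
        also have "\<dots> = (T ^^ (K + l)) ((F ^^ Suc (n k)) y, 0)"
          using t[OF y] by (simp add: funpow_add)
        finally show ?thesis
          using funpow_space[OF ys, of "Suc (n k)"] by (simp add: W_def)
      qed
      then show ?thesis
        using small W by blast
    qed
    define D where "D = (\<lambda>K. {z \<in> space \<nu>. \<forall>\<^sub>F k in sequentially. z \<in> B (t k + K)})"
    have D: "D K \<in> sets \<nu>" for K
    proof -
      have "D K = (\<Union>j. \<Inter>k\<in>{j..}. B (t k + K)) \<inter> space \<nu>"
        by (auto simp: D_def eventually_sequentially)
      then show ?thesis
        using B(1) by auto
    qed
    have \<nu>_D: "emeasure \<nu> (D K) \<le> emeasure \<nu> A" for K
      by (rule emeasure_le_if_eventually_in[where B = "\<lambda>k. B (t k + K)"])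
        (use B(1) D \<nu>_B in \<open>auto simp: D_def\<close>)
    have full: "AE z in tower. z \<in> b \<times> {0} \<longrightarrow> (T ^^ (K + l)) z \<in> D K" for K
    proof -
      have "AE y in M. \<forall>\<^sub>F k in sequentially. y \<in> space M - (W k K \<inter> b)"
      proof (rule borel_cantelli_AE1)
        show "W k K \<inter> b \<in> sets M" for k
          using W sets_P[OF b] by auto
        show "emeasure M (W k K \<inter> b) < \<infinity>" for k
          by (simp add: emeasure_eq_measure)
        show "summable (\<lambda>k. measure M (W k K \<inter> b))"
          by (rule summable_comparison_test'[OF summable_geometric[of "1 / 2 :: real"]])
            (use W_small in auto)
      qed
      then have "AE y in M. y \<in> b \<longrightarrow> (T ^^ (K + l)) (y, 0) \<in> D K"
        using AE_space
      proof eventually_elim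
        case (elim y)
        show ?case
        proof
          assume "y \<in> b"
          have "(T ^^ (K + l)) (y, 0) \<in> space \<nu>"
            by (rule T_space) (use elim(2) in \<open>simp add: space_\<nu> space_tower R_pos\<close>)
          moreover have "\<forall>\<^sub>F k in sequentially. (T ^^ (K + l)) (y, 0) \<in> B (t k + K)"
            using elim(1) by eventually_elim (use \<open>y \<in> b\<close> in \<open>auto simp: W_def\<close>)
          ultimately show "(T ^^ (K + l)) (y, 0) \<in> D K"
            by (simp add: D_def)
        qed
      qed
      then have "AE y in M. j < R y \<longrightarrow> (y, j) \<in> b \<times> {0} \<longrightarrow> (T ^^ (K + l)) (y, j) \<in> D K" for j
        by (cases "j = 0") auto
      then show ?thesis
        unfolding AE_tower by blast
    qed
    have cell: "AE z in tower. z \<in> a \<times> {j} \<longrightarrow> (\<forall>\<^sub>F K in sequentially. z \<in> D K)" if "a \<in> P" for a j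
    proof -
      obtain N where N: "\<And>s. N \<le> s \<Longrightarrow> covers s (b \<times> {0}) (a \<times> {j})"
        using eventually_covers[OF b \<open>a \<in> P\<close>] by blast
      have "AE z in tower. z \<in> a \<times> {j} \<longrightarrow> z \<in> D K" if "N \<le> K" for K
        using N[of "K + l"] that full[of K] unfolding covers_def by auto
      then have "AE z in tower. \<forall>K\<in>{N..}. z \<in> a \<times> {j} \<longrightarrow> z \<in> D K"
        by (subst AE_ball_countable) auto
      then show ?thesis
        by eventually_elim (auto simp: eventually_sequentially)
    qed
    have "AE x in M. j < R x \<longrightarrow> (\<forall>\<^sub>F K in sequentially. (x, j) \<in> D K)" for j
    proof -
      have "AE x in M. j < R x \<longrightarrow> x \<in> a \<longrightarrow> (\<forall>\<^sub>F K in sequentially. (x, j) \<in> D K)" if "a \<in> P" for a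
      proof -
        have "AE x in M. j < R x \<longrightarrow> (x, j) \<in> a \<times> {j} \<longrightarrow> (\<forall>\<^sub>F K in sequentially. (x, j) \<in> D K)"
          using cell[OF that, of j] unfolding AE_tower by blast
        then show ?thesis by simp
      qed
      then have "AE x in M. \<forall>a\<in>P. j < R x \<longrightarrow> x \<in> a \<longrightarrow> (\<forall>\<^sub>F K in sequentially. (x, j) \<in> D K)"
        by (subst AE_ball_countable[OF countable_P]) blast
      with AE_regular show ?thesis
        by eventually_elim (use regular_ex in blast)
    qed
    then have "AE z in tower. \<forall>\<^sub>F K in sequentially. z \<in> D K"
      unfolding AE_tower by blast
    then have "AE z in \<nu>. \<forall>\<^sub>F K in sequentially. z \<in> D K"
      by (rule absolutely_continuous_AE[OF sets_\<nu> ac])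
    then have "emeasure \<nu> (space \<nu>) \<le> emeasure \<nu> A"
      by (intro emeasure_le_if_eventually_in[OF D _ _ \<nu>_D]) auto
    then have "emeasure \<nu> A = 1"
      using \<nu>.emeasure_space_1 \<nu>.emeasure_le_1[of A] by auto
    then show ?thesis ..
  qed simp
qed

end

theorem theorem4p5:
  fixes M :: "'a measure" and f F :: "'a \<Rightarrow> 'a" and \<Delta>\<^sub>0 :: "'a set"
    and P\<^sub>0 :: "'a set set" and R :: "'a \<Rightarrow> nat" and \<nu> :: "('a \<times> nat) measure"
  defines "m\<^sub>0 \<equiv> restrict_space M \<Delta>\<^sub>0"
  defines "m \<equiv> tower_measure m\<^sub>0 R"
  defines "T \<equiv> tower_map F R"
  assumes induced: "induced_map M f \<Delta>\<^sub>0 P\<^sub>0 R F"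
    and wgm: "weak_gibbs_markov m\<^sub>0 F P\<^sub>0"
    and aper: "aperiodic m\<^sub>0 F P\<^sub>0"
    and block: "coprime_block m\<^sub>0 F P\<^sub>0 R"
    and R_L1: "integrable m\<^sub>0 (\<lambda>x. real (R x))"
    and nu_sets: "sets \<nu> = sets m"
    and nu_prob: "prob_space \<nu>"
    and nu_inv: "invariant_measure \<nu> T"
    and nu_erg: "ergodic_measure \<nu> T"
    and nu_ac: "absolutely_continuous m \<nu>"
  shows "exact_measure \<nu> T"
proof -
  obtain J where J: "WGM_nonsingular m\<^sub>0 F P\<^sub>0 J" and "WGM_gibbs F P\<^sub>0 J"
    using wgm unfolding weak_gibbs_markov_def by blast
  then obtain C \<beta> where C: "0 < C" "0 < \<beta>" "\<beta> < 1"
    and gibbs: "\<forall>\<omega>\<in>P\<^sub>0. \<forall>x\<in>\<omega>. \<forall>y\<in>\<omega>. \<forall>n. separation_time F P\<^sub>0 (F x) (F y) = enat n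
                  \<longrightarrow> ln (J x / J y) \<le> C * \<beta> ^ n"
    unfolding WGM_gibbs_def by (elim exE conjE)
  interpret wgm_tower m\<^sub>0 F P\<^sub>0 J C \<beta> R
  proof
    show "R \<in> m\<^sub>0 \<rightarrow>\<^sub>M count_space UNIV" "\<And>\<omega>. \<omega> \<in> P\<^sub>0 \<Longrightarrow> R constant_on \<omega>"
      using induced by (auto simp: induced_map_def m\<^sub>0_def)
    show "0 < R x" if "x \<in> space m\<^sub>0" for x
      using induced that by (auto simp: induced_map_def m\<^sub>0_def space_restrict_space)
  qed (use wgm J C gibbs aper block in \<open>simp_all\<close>)
  show ?thesis
    unfolding T_def
    by (rule exact) (use nu_sets nu_prob nu_inv nu_ac in \<open>simp_all add: m_def T_def\<close>)
qed

end
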